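(* Let $n,k\ge 2$ and let $\phi_k:(\mathbb{C},0)\to(\mathbb{C}^k,0)$ be a primitive parameterized curve of the form $\phi_k(y)=(y^{m_1},\,y^{m_2}+\sum_{i>m_2}a_{i2}y^i,\ldots,\,y^{m_k}+\sum_{i>m_k}a_{ik}y^i)$ with $1<m_1\le m_2\le\cdots\le m_k$. Let $\lambda_1,\ldots,\lambda_{n-1}\ge 1$ be integers and write $\underline{x}=(x_1,\ldots,x_{n-1})$. Then the map-germ $f:(\mathbb{C}^n,0)\to(\mathbb{C}^{2n+k-2},0)$ given by $$f(\underline{x},y)=(\underline{x},\ \phi_k(y),\ x_1^{\lambda_1}y,\ldots,x_{n-1}^{\lambda_{n-1}}y)$$ (the join $(I*\phi_k)_H$ of the identity $I$ of $\mathbb{C}^{n-1}$ and $\phi_k$ with respect to $H(\underline{x},y)=(x_1^{\lambda_1}y,\ldots,x_{n-1}^{\lambda_{n-1}}y)$) is $\mathcal{A}$-finite and has corank $1$.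
   Context: All germs are holomorphic. Two germs $f,g:(\mathbb{C}^n,0)\to(\mathbb{C}^p,0)$ are $\mathcal{A}$-equivalent if $g=\psi\circ f\circ\rho^{-1}$ for germs of biholomorphisms $\rho$ of $(\mathbb{C}^n,0)$ and $\psi$ of $(\mathbb{C}^p,0)$. A germ $f$ is $\mathcal{A}$-finite (finitely determined) if there is $r<\infty$ such that every germ $g:(\mathbb{C}^n,0)\to(\mathbb{C}^p,0)$ with the same $r$-jet at $0$ as $f$ is $\mathcal{A}$-equivalent to $f$. The corank of $f:(\mathbb{C}^n,0)\to(\mathbb{C}^p,0)$, $p\ge n$, is $n-\operatorname{rank} df_0$. A parameterized curve of the form displayed in the claim (with complex coefficients, convergent series) is primitive if the greatest common divisor of all exponents occurring with nonzero coefficient in its components equals $1$, equivalently it is not a germ in a power $y^d$ with $d\ge 2$. For germs $F$ in variables $x$, $G$ in variables $y$ and $H$ in variables $(x,y)$, the join is $(F*G)_H(x,y)=(F(x),G(y),H(x,y))$. *)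

theory Defs
  imports "HOL-Analysis.Analysis" "HOL-Library.Numeral_Type"
begin

text \<open>
  Germs at the origin are represented by total functions between coordinate spaces
  \<open>complex ^ 'n\<close>, whose values matter only near \<open>0\<close>; equality of germs is equality on some
  neighbourhood of \<open>0\<close>.
\<close>

section \<open>Holomorphic germs\<close>

text \<open>Holomorphic near \<open>0\<close> means that the real Frechet derivative exists at every point near \<open>0\<close>
  and is complex linear, i.e. is multiplication by a complex matrix.\<close>

definition holomorphic_germ :: "(complex ^ 'n \<Rightarrow> complex ^ 'p) \<Rightarrow> bool" where
  "holomorphic_germ f \<longleftrightarrow> f 0 = 0 \<and>
     (\<forall>\<^sub>F x in nhds 0. \<exists>A :: complex ^ 'n ^ 'p. (f has_derivative (\<lambda>v. A *v v)) (at x))"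

definition inverse_germs :: "(complex ^ 'n \<Rightarrow> complex ^ 'n) \<Rightarrow> (complex ^ 'n \<Rightarrow> complex ^ 'n) \<Rightarrow> bool" where
  "inverse_germs \<rho> \<rho>' \<longleftrightarrow> holomorphic_germ \<rho> \<and> holomorphic_germ \<rho>' \<and>
     (\<forall>\<^sub>F x in nhds 0. \<rho>' (\<rho> x) = x) \<and> (\<forall>\<^sub>F x in nhds 0. \<rho> (\<rho>' x) = x)"

text \<open>Below, \<open>\<rho>'\<close> plays the role of the inverse germ of \<open>\<rho>\<close>, so the last conjunct says that
  \<open>g = \<psi> \<circ> f \<circ> \<rho>\<inverse>\<close> as germs.\<close>

definition A_equivalent :: "(complex ^ 'n \<Rightarrow> complex ^ 'p) \<Rightarrow> (complex ^ 'n \<Rightarrow> complex ^ 'p) \<Rightarrow> bool" where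
  "A_equivalent f g \<longleftrightarrow> (\<exists>\<rho> \<rho>' \<psi> \<psi>'. inverse_germs \<rho> \<rho>' \<and> inverse_germs \<psi> \<psi>' \<and>
     (\<forall>\<^sub>F x in nhds 0. g x = \<psi> (f (\<rho>' x))))"

section \<open>Jets and finite determinacy\<close>

definition cpartial :: "'n \<Rightarrow> (complex ^ 'n \<Rightarrow> complex) \<Rightarrow> complex ^ 'n \<Rightarrow> complex" where
  "cpartial i h x = deriv (\<lambda>t. h (x + t *s axis i 1)) 0"

text \<open>Lists of indices enumerate the iterated partial derivatives; \<open>length js\<close> is the order.\<close>

definition same_jet :: "nat \<Rightarrow> (complex ^ 'n \<Rightarrow> complex ^ 'p) \<Rightarrow> (complex ^ 'n \<Rightarrow> complex ^ 'p) \<Rightarrow> bool" where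
  "same_jet r f g \<longleftrightarrow> (\<forall>c js. length js \<le> r \<longrightarrow>
     foldr cpartial js (\<lambda>x. f x $ c) 0 = foldr cpartial js (\<lambda>x. g x $ c) 0)"

definition A_finite :: "(complex ^ 'n \<Rightarrow> complex ^ 'p) \<Rightarrow> bool" where
  "A_finite f \<longleftrightarrow> holomorphic_germ f \<and>
     (\<exists>r. \<forall>g. holomorphic_germ g \<and> same_jet r f g \<longrightarrow> A_equivalent f g)"

text \<open>For a holomorphic germ the matrix below is the complex Jacobian matrix at \<open>0\<close>, and \<open>rank\<close>
  is its rank over the complex field. The notion is only used if \<open>CARD('n) \<le> CARD('p)\<close>.\<close>

definition corank :: "(complex ^ 'n \<Rightarrow> complex ^ 'p) \<Rightarrow> nat" where
  "corank f = CARD('n) - rank (matrix (frechet_derivative f (at 0)))"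

section \<open>Joins\<close>

text \<open>A point of \<open>complex ^ ('a + 'b)\<close> is a pair \<open>(x, y)\<close> with \<open>x\<close> in \<open>complex ^ 'a\<close> and \<open>y\<close> in
  \<open>complex ^ 'b\<close>.\<close>

definition xpart :: "complex ^ ('a :: finite + 'b :: finite) \<Rightarrow> complex ^ 'a" where
  "xpart z = (\<chi> i. z $ Inl i)"

definition ypart :: "complex ^ ('a :: finite + 'b :: finite) \<Rightarrow> complex ^ 'b" where
  "ypart z = (\<chi> j. z $ Inr j)"

definition join :: "(complex ^ 'a :: finite \<Rightarrow> complex ^ 'c :: finite) \<Rightarrow> (complex ^ 'b :: finite \<Rightarrow> complex ^ 'd :: finite) \<Rightarrow>
    (complex ^ ('a + 'b) \<Rightarrow> complex ^ 'e :: finite) \<Rightarrow> complex ^ ('a + 'b) \<Rightarrow> complex ^ ('c + 'd + 'e)" where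
  "join F G H z = (\<chi> s. case s of
       Inl i \<Rightarrow> F (xpart z) $ i
     | Inr (Inl j) \<Rightarrow> G (ypart z) $ j
     | Inr (Inr l) \<Rightarrow> H z $ l)"

section \<open>Primitive parameterized curves\<close>

text \<open>The components are indexed by a finite linear order \<open>'k\<close>, with first index \<open>Min UNIV\<close>.
  The first component is exactly \<open>y ^ m\<^sub>1\<close>, the others have leading term \<open>y ^ m\<^sub>j\<close> with coefficient
  one; \<open>a j i\<close> is the coefficient of \<open>y ^ i\<close> in component \<open>j\<close> and is ignored unless \<open>i > m j\<close>.\<close>

definition curve_series ::
    "('k :: {finite, linorder} \<Rightarrow> nat) \<Rightarrow> ('k \<Rightarrow> nat \<Rightarrow> complex) \<Rightarrow> 'k \<Rightarrow> complex fps" where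
  "curve_series m a j = fps_X ^ m j +
     (if j = Min UNIV then 0 else Abs_fps (\<lambda>i. if i > m j then a j i else 0))"

definition curve :: "('k :: finite \<Rightarrow> complex fps) \<Rightarrow> complex ^ 1 \<Rightarrow> complex ^ 'k" where
  "curve \<phi> y = (\<chi> j. eval_fps (\<phi> j) (y $ 1))"

definition primitive :: "('k \<Rightarrow> complex fps) \<Rightarrow> bool" where
  "primitive \<phi> \<longleftrightarrow> Gcd {i. \<exists>j. fps_nth (\<phi> j) i \<noteq> 0} = (1 :: nat)"

section \<open>The map-germ\<close>

definition xpow_times_y :: "('a :: finite \<Rightarrow> nat) \<Rightarrow> complex ^ ('a + 1) \<Rightarrow> complex ^ 'a" where
  "xpow_times_y lam z = (\<chi> i. (z $ Inl i) ^ lam i * z $ Inr 1)"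

lemma join_components:
  fixes \<phi> :: "'k :: finite \<Rightarrow> complex fps" and lam :: "'a :: finite \<Rightarrow> nat"
  defines "f \<equiv> join id (curve \<phi>) (xpow_times_y lam)"
  shows "f z $ Inl i = z $ Inl i"
    and "f z $ Inr (Inl j) = eval_fps (\<phi> j) (z $ Inr 1)"
    and "f z $ Inr (Inr i) = (z $ Inl i) ^ lam i * z $ Inr 1"
  by (simp_all add: f_def join_def curve_def xpow_times_y_def xpart_def ypart_def)

text \<open>With \<open>n = CARD('a) + 1\<close> (so \<open>n \<ge> 2\<close>, as \<open>'a\<close> is nonempty) and \<open>k = CARD('k)\<close>, the germ above
  maps an \<open>n\<close>-dimensional space to a \<open>(2 * n + k - 2)\<close>-dimensional one.\<close>

lemma source_target_dimensions:
  assumes "n = CARD('a :: finite) + 1" and "k = CARD('k :: finite)"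
  shows "n \<ge> 2" and "CARD('a + 1) = n" and "CARD('a + 'k + 'a) = 2 * n + k - 2"
  using assms zero_less_card_finite[where 'a = 'a] by (auto simp: card_UNIV_sum)

end

theory Submission
  imports Defs "HOL-Complex_Analysis.Complex_Analysis"
begin

text \<open>
  The germ \<open>f\<close> is finitely determined already for left equivalence: every holomorphic \<open>h\<close> that
  vanishes to high order at \<open>0\<close> is \<open>H \<circ> f\<close> with \<open>H\<close> holomorphic and \<open>H 0 = 0\<close>, \<open>H' 0 = 0\<close>. Hence if \<open>g\<close>
  has the same jet as \<open>f\<close>, then \<open>g = (id + H) \<circ> f\<close> for such a vector \<open>H\<close>, and \<open>id + H\<close> is invertible.

  To produce \<open>H\<close>, write \<open>h = y ^ c * k + (\<Sum>i. x i ^ L * u i)\<close> with \<open>c\<close> and \<open>L\<close> large, and expand each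
  \<open>u i\<close> in powers of \<open>y\<close> below \<open>y ^ c\<close>. A term \<open>x i ^ L * y ^ b * q x\<close> with \<open>b < c\<close> is a function of
  \<open>x\<close> and \<open>x i ^ lam i * y\<close>. A term \<open>y ^ c * k\<close> is a function of \<open>x\<close> and the curve because the
  curve is primitive: its components together separate the points \<open>\<zeta> * y\<close> with \<open>\<zeta> ^ m\<^sub>1 = 1\<close>, and
  interpolation over these conjugates expresses \<open>k\<close> times a power of \<open>y\<close> through the curve.
\<close>

section \<open>Complex differentiability in several variables\<close>

text \<open>The geometric reason is that \<open>f\<close> is injective and immersive near but off
  the origin: \<open>y\<close> is recovered from the last block of components where some
  \<open>x i \<noteq> 0\<close>, and from the primitive curve where \<open>y \<noteq> 0\<close>. The
  powers \<open>L\<close> and \<open>c\<close> are the price of this recovery, and any monomial of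
  degree above the sum of all the exponents is divisible by one of the chosen powers.

  The condition \<open>H' 0 = 0\<close> is obtained by writing every summand of \<open>H\<close> as
  a product of two germs vanishing at \<open>0\<close>. This is the origin of the summand
  \<open>2\<close> in \<open>L\<close> and of the summand \<open>2 * M\<close> in \<open>c\<close>,
  where \<open>M\<close> is the first exponent of the curve.

  Holomorphy is given as complex differentiability near \<open>0\<close>, so the proof avoids Taylor
  series in several variables: division by one coordinate at a time replaces expansion, and a growth
  bound replaces the order of a series. The obstacle is then the regularity of a quotient along the
  hyperplane that was divided out. Osgood's lemma reduces it to functions of one variable.\<close>

definition cdiff_at :: "(complex ^ 'n \<Rightarrow> complex) \<Rightarrow> complex ^ 'n \<Rightarrow> bool" where
  "cdiff_at h x \<longleftrightarrow> (\<exists>A :: complex ^ 'n. (h has_derivative (\<lambda>v. \<Sum>i\<in>UNIV. A $ i * v $ i)) (at x))"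

text \<open>Coordinates are set to zero rather than dropped, so a function of fewer variables keeps
  its type and inductions over sets of variables stay within one index type.\<close>

definition restr :: "'n set \<Rightarrow> complex ^ 'n \<Rightarrow> complex ^ 'n" where
  "restr S z = (\<chi> i. if i \<in> S then z $ i else 0)"

lemma norm_axis_scale [simp]: "norm (t *s axis i (1 :: complex)) = norm t"
proof -
  have "t *s axis i (1 :: complex) = axis i t"
    by (simp add: vec_eq_iff axis_def)
  then show ?thesis by (simp add: norm_vec_def L2_set_def axis_def if_distrib[where f = norm] if_distrib[where f = "\<lambda>x. x\<^sup>2"] cong: if_cong)
qed

lemma bounded_linear_axis_scale: "bounded_linear (\<lambda>t. t *s axis i (1 :: complex))"
  by (rule bounded_linear_intro[where K = 1])
    (auto simp: vec_eq_iff vector_sadd_rdistrib)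

lemmas axis_scale_intros [derivative_intros] = bounded_linear.has_derivative[OF bounded_linear_axis_scale]
lemmas continuous_axis_scale [continuous_intros] = bounded_linear.continuous_on[OF bounded_linear_axis_scale]
lemmas tendsto_axis_scale [tendsto_intros] = bounded_linear.tendsto[OF bounded_linear_axis_scale]

lemma cdiff_at_imp_continuous: "cdiff_at h x \<Longrightarrow> isCont h x"
  unfolding cdiff_at_def using has_derivative_continuous by blast

lemma cdiff_on_imp_continuous_on: "(\<And>x. x \<in> U \<Longrightarrow> cdiff_at h x) \<Longrightarrow> continuous_on U h"
  by (simp add: cdiff_at_imp_continuous continuous_at_imp_continuous_on)

lemma cdiff_at_slice_derivative:
  fixes h :: "complex ^ 'n \<Rightarrow> complex"
  assumes "(h has_derivative (\<lambda>v. \<Sum>j\<in>UNIV. A $ j * v $ j)) (at (x + t *s axis i 1))"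
  shows "((\<lambda>t. h (x + t *s axis i 1)) has_field_derivative A $ i) (at t)"
proof -
  have "((\<lambda>t. x + t *s axis i 1) has_derivative (\<lambda>t. t *s axis i 1)) (at t)"
    by (auto intro!: derivative_eq_intros)
  from has_derivative_compose[OF this assms]
  have "((\<lambda>t. h (x + t *s axis i 1)) has_derivative (\<lambda>t. \<Sum>j\<in>UNIV. A $ j * (t *s axis i 1) $ j)) (at t)" .
  moreover have "(\<Sum>j\<in>UNIV. A $ j * (t *s axis i 1) $ j) = A $ i * t" for t
    by (simp add: axis_def if_distrib cong: if_cong)
  ultimately show ?thesis by (simp add: has_field_derivative_def)
qed

lemma cdiff_at_slice:
  fixes h :: "complex ^ 'n \<Rightarrow> complex"
  assumes "cdiff_at h (x + t *s axis i 1)"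
  shows "(\<lambda>t. h (x + t *s axis i 1)) field_differentiable (at t)"
  using assms cdiff_at_slice_derivative unfolding cdiff_at_def field_differentiable_def by blast

lemma cdiff_at_cpartial:
  fixes h :: "complex ^ 'n \<Rightarrow> complex"
  assumes "cdiff_at h x"
  shows "(h has_derivative (\<lambda>v. \<Sum>i\<in>UNIV. cpartial i h x * v $ i)) (at x)"
proof -
  obtain A where A: "(h has_derivative (\<lambda>v. \<Sum>i\<in>UNIV. A $ i * v $ i)) (at x)"
    using assms by (auto simp: cdiff_at_def)
  have "cpartial i h x = A $ i" for i
    unfolding cpartial_def by (rule DERIV_imp_deriv, rule cdiff_at_slice_derivative) (use A in simp)
  with A show ?thesis by simp
qed

section \<open>Partial derivatives along complex lines\<close>

text \<open>Separate differentiability is assumed only at parameter \<open>0\<close> of a slice.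
  Re-basing the same complex line at another of its points gives it at every parameter, so
  one-variable theory applies on whole discs.\<close>

lemma slice_shift:
  fixes h :: "complex ^ 'n \<Rightarrow> complex"
  assumes "(\<lambda>s. h ((x + t *s axis i 1) + s *s axis i 1)) field_differentiable (at 0)"
  shows "((\<lambda>s. h (x + s *s axis i 1)) has_field_derivative cpartial i h (x + t *s axis i 1)) (at t)"
proof -
  let ?F = "\<lambda>s. h ((x + t *s axis i 1) + s *s axis i 1)"
  have "(?F has_field_derivative cpartial i h (x + t *s axis i 1)) (at (t - t))"
    using assms by (simp add: cpartial_def DERIV_deriv_iff_field_differentiable)
  then have "((\<lambda>s. ?F (s - t)) has_field_derivative cpartial i h (x + t *s axis i 1) * 1) (at t)"
    by (rule DERIV_chain2) (auto intro!: derivative_eq_intros)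
  moreover have "?F (s - t) = h (x + s *s axis i 1)" for s
    by (rule arg_cong[where f = h]) (simp add: vec_eq_iff algebra_simps)
  ultimately show ?thesis by simp
qed

lemma ball_axis: "t \<in> ball 0 r \<Longrightarrow> x + t *s axis i (1 :: complex) \<in> ball x r"
  and cball_axis: "t \<in> cball 0 r \<Longrightarrow> x + t *s axis i (1 :: complex) \<in> cball x r"
  by (simp_all add: dist_norm)

lemma slice_holomorphic:
  fixes h :: "complex ^ 'n \<Rightarrow> complex"
  assumes sep: "\<And>x. x \<in> U \<Longrightarrow> (\<lambda>t. h (x + t *s axis i 1)) field_differentiable (at 0)"
    and sub: "ball x r \<subseteq> U"
  shows "(\<lambda>t. h (x + t *s axis i 1)) holomorphic_on ball 0 r"
proof (rule holomorphic_onI)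
  fix t :: complex assume "t \<in> ball 0 r"
  then have "x + t *s axis i 1 \<in> U" using ball_axis sub by blast
  from slice_shift[OF sep[OF this]]
  show "(\<lambda>t. h (x + t *s axis i 1)) field_differentiable at t within ball 0 r"
    using field_differentiable_at_within field_differentiable_def by blast
qed

lemma continuous_on_slice:
  fixes h :: "complex ^ 'n \<Rightarrow> complex"
  assumes "continuous_on U h" "cball x r \<subseteq> U"
  shows "continuous_on (cball 0 r) (\<lambda>t. h (x + t *s axis i 1))"
proof (rule continuous_on_compose2[OF assms(1)])
  show "continuous_on (cball 0 r) (\<lambda>t. x + t *s axis i 1)"
    by (intro continuous_intros)
  show "(\<lambda>t. x + t *s axis i 1) ` cball 0 r \<subseteq> U"
    using assms(2) cball_axis by blast
qed

text \<open>Cauchy's inequality, applied to the difference of two parallel slices, bounds the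
  difference of their derivatives by that of their values on a circle. Uniform continuity of
  \<open>h\<close> on a compact ball makes the latter small.\<close>

lemma continuous_on_cpartial:
  fixes h :: "complex ^ 'n \<Rightarrow> complex"
  assumes "open U" and cont: "continuous_on U h"
    and sep: "\<And>x. x \<in> U \<Longrightarrow> (\<lambda>t. h (x + t *s axis i 1)) field_differentiable (at 0)"
  shows "continuous_on U (cpartial i h)"
proof (rule continuous_at_imp_continuous_on, rule ballI)
  fix x0 assume "x0 \<in> U"
  then obtain r0 where r0: "r0 > 0" "cball x0 r0 \<subseteq> U"
    using \<open>open U\<close> open_contains_cball by blast
  define r where "r = r0 / 2"
  have r: "r > 0" "cball x0 (2 * r) \<subseteq> U" using r0 by (auto simp: r_def)
  have uc: "uniformly_continuous_on (cball x0 (2 * r)) h"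
    by (rule compact_uniformly_continuous) (use cont r continuous_on_subset in auto)
  show "isCont (cpartial i h) x0"
    unfolding continuous_at_eps_delta
  proof (intro allI impI)
    fix e :: real assume "e > 0"
    \<comment> \<open>Cauchy's inequality on the circle of radius \<open>r\<close> divides by
      \<open>r\<close>, which leaves \<open>e / 2\<close>.\<close>
    then have "e * r / 2 > 0" using r by simp
    then obtain d where d: "d > 0"
      "\<And>x y. x \<in> cball x0 (2 * r) \<Longrightarrow> y \<in> cball x0 (2 * r) \<Longrightarrow> dist y x < d \<Longrightarrow> dist (h y) (h x) < e * r / 2"
      using uc unfolding uniformly_continuous_on_def by metis
    show "\<exists>d>0. \<forall>x'. dist x' x0 < d \<longrightarrow> dist (cpartial i h x') (cpartial i h x0) < e"
    proof (intro exI conjI allI impI)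
      show "min d r > 0" using d r by simp
      fix x' assume x': "dist x' x0 < min d r"
      have sub: "cball x' r \<subseteq> cball x0 (2 * r)"
        using x' by (intro cball_subset_cball_iff[THEN iffD2]) (auto simp: dist_commute)
      have sub0: "cball x0 r \<subseteq> cball x0 (2 * r)"
        using r by (intro cball_subset_cball_iff[THEN iffD2]) auto
      define F where "F = (\<lambda>t. h (x' + t *s axis i 1))"
      define G where "G = (\<lambda>t. h (x0 + t *s axis i 1))"
      have hol: "F holomorphic_on ball 0 r" "G holomorphic_on ball 0 r"
        unfolding F_def G_def
        by (rule slice_holomorphic[OF sep]; use sub sub0 r ball_subset_cball in blast)+
      have "continuous_on (cball 0 r) F" "continuous_on (cball 0 r) G"
        unfolding F_def G_def
        by (rule continuous_on_slice[OF cont], use sub sub0 r in blast)+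
      then have contd: "continuous_on (cball 0 r) (\<lambda>t. F t - G t)"
        by (intro continuous_intros)
      have hold: "(\<lambda>t. F t - G t) holomorphic_on ball 0 r"
        using hol by (intro holomorphic_intros)
      have "norm ((deriv ^^ 1) (\<lambda>t. F t - G t) 0) \<le> fact 1 * (e * r / 2) / r ^ 1"
      proof (rule Cauchy_inequality[OF hold contd r(1)])
        fix t :: complex assume t: "norm (0 - t) = r"
        have "dist (F t) (G t) < e * r / 2"
          unfolding F_def G_def
        proof (rule d(2))
          show "x0 + t *s axis i 1 \<in> cball x0 (2 * r)" "x' + t *s axis i 1 \<in> cball x0 (2 * r)"
            using cball_axis[of t r x' i] cball_axis[of t r x0 i] t sub sub0 by auto
          show "dist (x' + t *s axis i 1) (x0 + t *s axis i 1) < d"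
            using x' by simp
        qed
        then show "norm (F t - G t) \<le> e * r / 2" by (simp add: dist_norm)
      qed
      moreover have "deriv (\<lambda>t. F t - G t) 0 = deriv F 0 - deriv G 0"
        by (rule deriv_diff) (use hol r in \<open>auto simp: holomorphic_on_imp_differentiable_at\<close>)
      ultimately have "norm (deriv F 0 - deriv G 0) \<le> e / 2" using r by simp
      then show "dist (cpartial i h x') (cpartial i h x0) < e"
        using \<open>e > 0\<close> by (simp add: cpartial_def F_def G_def dist_norm)
    qed
  qed
qed

lemma norm_restr_le: "norm (restr S z) \<le> norm z"
  by (rule norm_le_componentwise_cart) (simp add: restr_def)

lemma restr_insert: "i \<notin> S \<Longrightarrow> restr (insert i S) z = restr S z + (z $ i) *s axis i 1"
  by (auto simp: vec_eq_iff restr_def axis_def)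

text \<open>Osgood's lemma: telescope the increment along the coordinates.\<close>

lemma Osgood:
  fixes h :: "complex ^ 'n \<Rightarrow> complex"
  assumes "open U" and cont: "continuous_on U h"
    and sep: "\<And>x i. x \<in> U \<Longrightarrow> (\<lambda>t. h (x + t *s axis i 1)) field_differentiable (at 0)"
    and "x0 \<in> U"
  shows "cdiff_at h x0"
proof -
  have claim: "\<exists>d>0. \<forall>v. norm v < d \<longrightarrow>
      norm (h (x0 + restr S v) - h x0 - (\<Sum>i\<in>S. cpartial i h x0 * v $ i)) \<le> e * norm v"
    if "finite S" "e > 0" for S and e :: real
    using that
  proof (induction S arbitrary: e rule: finite_induct)
    case empty
    have "restr {} v = 0" for v :: "complex ^ 'n" by (simp add: restr_def vec_eq_iff)
    then show ?case using empty by (intro exI[of _ 1]) simp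
  next
    case (insert i S)
    have "e / 2 > 0" using insert by simp
    from insert.IH[OF this] obtain d1 where d1: "d1 > 0"
      "\<And>v. norm v < d1 \<Longrightarrow> norm (h (x0 + restr S v) - h x0 - (\<Sum>i\<in>S. cpartial i h x0 * v $ i)) \<le> e / 2 * norm v"
      by blast
    obtain r where r: "r > 0" "ball x0 r \<subseteq> U" using assms open_contains_ball by blast
    have "isCont (cpartial i h) x0"
      using continuous_on_cpartial[OF assms(1,2) sep] assms(1,4) continuous_on_eq_continuous_at by blast
    then obtain d2 where d2: "d2 > 0"
      "\<And>x. dist x x0 < d2 \<Longrightarrow> dist (cpartial i h x) (cpartial i h x0) < e / 2"
      unfolding continuous_at_eps_delta using \<open>e / 2 > 0\<close> by blast
    \<comment> \<open>The points visited are \<open>x0 + restr S v + t *s axis i 1\<close> with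
      \<open>norm t \<le> norm v\<close>, at distance up to \<open>2 * norm v\<close> from
      \<open>x0\<close>; hence the factor \<open>1 / 2\<close>.\<close>
    define d where "d = min d1 (min r d2 / 2)"
    show ?case
    proof (intro exI conjI allI impI)
      show "d > 0" using d1 d2 r by (simp add: d_def)
      fix v :: "complex ^ 'n" assume v: "norm v < d"
      define x where "x = x0 + restr S v"
      \<comment> \<open>With the linear part at \<open>x0\<close> removed, the derivative of
        \<open>F\<close> is a difference of values of the partial derivative, small by its
        continuity.\<close>
      define F where "F = (\<lambda>t. h (x + t *s axis i 1) - cpartial i h x0 * t)"
      have close: "dist (x + t *s axis i 1) x0 < min r d2" if "t \<in> cball 0 (norm v)" for t
      proof -
        have "norm (restr S v + t *s axis i 1) \<le> norm v + norm v"
          using norm_restr_le[of S v] that norm_triangle_mono[of "restr S v" "norm v" "t *s axis i 1" "norm v"] by simp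
        also have "\<dots> < min r d2" using v by (simp add: d_def)
        finally show ?thesis by (simp add: x_def dist_norm add.assoc)
      qed
      have "norm (F (v $ i) - F 0) \<le> e / 2 * norm (v $ i - 0)"
      proof (rule field_differentiable_bound[where S = "cball 0 (norm v)" and
            f' = "\<lambda>t. cpartial i h (x + t *s axis i 1) - cpartial i h x0"])
        fix t :: complex assume t: "t \<in> cball 0 (norm v)"
        have "x + t *s axis i 1 \<in> U" using close[OF t] r by (auto simp: dist_commute)
        note slice_shift[OF sep[OF this]]
        from DERIV_diff[OF this DERIV_cmult_Id]
        show "(F has_field_derivative cpartial i h (x + t *s axis i 1) - cpartial i h x0) (at t within cball 0 (norm v))"
          unfolding F_def
          by (rule has_field_derivative_at_within)
        show "norm (cpartial i h (x + t *s axis i 1) - cpartial i h x0) \<le> e / 2"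
          using d2(2)[of "x + t *s axis i 1"] close[OF t] by (simp add: dist_norm)
      qed (simp_all add: Finite_Cartesian_Product.norm_nth_le)
      also have "\<dots> \<le> e / 2 * norm v"
        using \<open>e / 2 > 0\<close> Finite_Cartesian_Product.norm_nth_le[of v i] by (intro mult_left_mono) auto
      finally have 1: "norm (F (v $ i) - F 0) \<le> e / 2 * norm v" .
      have 2: "norm (h x - h x0 - (\<Sum>i\<in>S. cpartial i h x0 * v $ i)) \<le> e / 2 * norm v"
        unfolding x_def by (rule d1(2)) (use v in \<open>simp add: d_def\<close>)
      have "h (x0 + restr (insert i S) v) - h x0 - (\<Sum>i\<in>insert i S. cpartial i h x0 * v $ i)
          = (F (v $ i) - F 0) + (h x - h x0 - (\<Sum>i\<in>S. cpartial i h x0 * v $ i))"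
        using insert by (simp add: restr_insert F_def x_def add.assoc algebra_simps)
      also have "norm \<dots> \<le> e / 2 * norm v + e / 2 * norm v"
        by (rule norm_triangle_mono[OF 1 2])
      finally show "norm (h (x0 + restr (insert i S) v) - h x0 - (\<Sum>i\<in>insert i S. cpartial i h x0 * v $ i)) \<le> e * norm v"
        by simp
    qed
  qed
  have restr_UNIV: "restr UNIV v = v" for v :: "complex ^ 'n" by (simp add: restr_def)
  have lin: "bounded_linear (\<lambda>v. \<Sum>i\<in>UNIV. (\<chi> i. cpartial i h x0) $ i * v $ i)"
    by (intro bounded_linear_sum bounded_linear_mult_right[THEN bounded_linear_compose] bounded_linear_vec_nth)
  show ?thesis
    unfolding cdiff_at_def
  proof (intro exI[of _ "\<chi> i. cpartial i h x0"] has_derivative_at_alt[THEN iffD2] conjI lin allI impI)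
    fix e :: real assume "e > 0"
    from claim[of UNIV, OF _ this] obtain d where d: "d > 0"
      "\<And>v. norm v < d \<Longrightarrow> norm (h (x0 + v) - h x0 - (\<Sum>i\<in>UNIV. cpartial i h x0 * v $ i)) \<le> e * norm v"
      by (auto simp: restr_UNIV)
    show "\<exists>d>0. \<forall>y. norm (y - x0) < d \<longrightarrow>
      norm (h y - h x0 - (\<Sum>i\<in>UNIV. (\<chi> i. cpartial i h x0) $ i * (y - x0) $ i)) \<le> e * norm (y - x0)"
      using d(1) d(2)[of "y - x0" for y] by (auto intro!: exI[of _ d])
  qed
qed

section \<open>Closure properties of complex differentiability\<close>

text \<open>A Frechet derivative is additive already, so homogeneity over the complex numbers is all
  that is left to check. The closure rules below can thus reuse the real differentiation rules
  without handling coefficients.\<close>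

lemma cdiff_atI:
  assumes L: "(h has_derivative L) (at x)" and scale: "\<And>c v. L (c *s v) = c * L v"
  shows "cdiff_at h x"
proof -
  have lin: "linear L" using has_derivative_bounded_linear[OF L] by (rule bounded_linear.linear)
  have "L = (\<lambda>v. \<Sum>i\<in>UNIV. (\<chi> i. L (axis i 1)) $ i * v $ i)"
  proof
    fix v
    have "L v = L (\<Sum>i\<in>UNIV. (v $ i) *s axis i 1)" by (simp add: basis_expansion)
    then show "L v = (\<Sum>i\<in>UNIV. (\<chi> i. L (axis i 1)) $ i * v $ i)"
      by (simp add: linear_sum[OF lin] scale mult.commute)
  qed
  with L show ?thesis unfolding cdiff_at_def by metis
qed

lemma cdiff_atE:
  assumes "cdiff_at h x"
  obtains L where "(h has_derivative L) (at x)" "\<And>c v. L (c *s v) = c * L v"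
proof -
  obtain A where "(h has_derivative (\<lambda>v. \<Sum>i\<in>UNIV. A $ i * v $ i)) (at x)"
    using assms by (auto simp: cdiff_at_def)
  then show ?thesis by (rule that) (simp add: sum_distrib_left mult_ac)
qed

lemma cdiff_at_const: "cdiff_at (\<lambda>_. c) x"
  by (rule cdiff_atI[where L = "\<lambda>_. 0"]) auto

lemma cdiff_at_nth: "cdiff_at (\<lambda>z. z $ i) x"
  by (rule cdiff_atI[where L = "\<lambda>z. z $ i"])
    (auto intro!: bounded_linear_imp_has_derivative bounded_linear_vec_nth)

lemma cdiff_at_add: "cdiff_at f x \<Longrightarrow> cdiff_at g x \<Longrightarrow> cdiff_at (\<lambda>z. f z + g z) x"
  by (elim cdiff_atE, rule cdiff_atI, erule (1) has_derivative_add) (simp add: algebra_simps)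

lemma cdiff_at_diff: "cdiff_at f x \<Longrightarrow> cdiff_at g x \<Longrightarrow> cdiff_at (\<lambda>z. f z - g z) x"
  by (elim cdiff_atE, rule cdiff_atI, erule (1) has_derivative_diff) (simp add: algebra_simps)

lemma cdiff_at_mult: "cdiff_at f x \<Longrightarrow> cdiff_at g x \<Longrightarrow> cdiff_at (\<lambda>z. f z * g z) x"
  by (elim cdiff_atE, rule cdiff_atI, erule (1) has_derivative_mult) (simp add: algebra_simps)

lemma cdiff_at_compose_univariate:
  assumes p: "p field_differentiable (at (q x))" and q: "cdiff_at q x"
  shows "cdiff_at (\<lambda>z. p (q z)) x"
proof -
  obtain d where "(p has_field_derivative d) (at (q x))"
    using p by (auto simp: field_differentiable_def)
  then have d: "(p has_derivative (\<lambda>t. d * t)) (at (q x))"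
    by (simp add: has_field_derivative_def)
  from q obtain L where "(q has_derivative L) (at x)" "\<And>c v. L (c *s v) = c * L v"
    by (rule cdiff_atE) (rule that)
  then show ?thesis
    using has_derivative_compose[of q L x UNIV p "\<lambda>t. d * t"] d by (intro cdiff_atI[where L = "\<lambda>v. d * L v"]) auto
qed

lemma has_derivative_vecI:
  fixes G :: "'b :: real_normed_vector \<Rightarrow> complex ^ 'n"
  assumes "\<And>j. ((\<lambda>z. G z $ j) has_derivative (\<lambda>v. L v $ j)) (at x)"
  shows "(G has_derivative L) (at x)"
proof -
  have "((\<lambda>z. \<Sum>j\<in>UNIV. (G z $ j) *s axis j (1 :: complex)) has_derivative (\<lambda>v. \<Sum>j\<in>UNIV. (L v $ j) *s axis j 1)) (at x)"
    by (intro has_derivative_sum axis_scale_intros assms)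
  then show ?thesis by (simp add: basis_expansion)
qed

lemma cdiff_at_compose:
  fixes G :: "complex ^ 'm \<Rightarrow> complex ^ 'n"
  assumes h: "cdiff_at h (G x)" and G: "\<And>j. cdiff_at (\<lambda>z. G z $ j) x"
  shows "cdiff_at (\<lambda>z. h (G z)) x"
proof -
  have "\<exists>L. ((\<lambda>z. G z $ j) has_derivative L) (at x) \<and> (\<forall>c v. L (c *s v) = c * L v)" for j
    using G[of j] by (elim cdiff_atE) blast
  then obtain L where L: "\<And>j. ((\<lambda>z. G z $ j) has_derivative L j) (at x)"
    "\<And>j c v. L j (c *s v) = c * L j v" by metis
  have der: "(G has_derivative (\<lambda>v. \<chi> j. L j v)) (at x)"
    by (rule has_derivative_vecI) (use L in simp)
  have [simp]: "(\<chi> j. c * L j v) = c *s (\<chi> j. L j v)" for c v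
    by (simp add: vec_eq_iff)
  from h obtain M where "(h has_derivative M) (at (G x))" "\<And>c v. M (c *s v) = c * M v"
    by (rule cdiff_atE) (rule that)
  then show ?thesis
    by (intro cdiff_atI[OF has_derivative_compose[OF der]]) (auto simp: L)
qed

lemma cdiff_at_transform:
  assumes "cdiff_at f x" "\<forall>\<^sub>F z in nhds x. f z = g z"
  shows "cdiff_at g x"
proof -
  have "f x = g x" using assms(2) by (rule eventually_nhds_x_imp_x)
  moreover have "\<forall>\<^sub>F z in at x. f z = g z"
    using assms(2) by (simp add: eventually_at_filter eventually_mono)
  ultimately show ?thesis
    using assms(1) unfolding cdiff_at_def by (blast intro: has_derivative_transform_eventually)
qed

section \<open>Germs of holomorphic functions\<close>

text \<open>There is no normalisation at \<open>0\<close>, in contrast to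
  \<open>holomorphic_germ\<close>: quotients and coefficient functions are arbitrary elements of the
  local ring.\<close>

definition holo :: "(complex ^ 'n \<Rightarrow> complex) \<Rightarrow> bool" where
  "holo h \<longleftrightarrow> (\<forall>\<^sub>F x in nhds 0. cdiff_at h x)"

lemma holo_imp_cdiff: "holo h \<Longrightarrow> cdiff_at h 0"
  unfolding holo_def by (rule eventually_nhds_x_imp_x)

lemma holo_tendsto: "holo h \<Longrightarrow> (h \<longlongrightarrow> h 0) (nhds 0)"
  using cdiff_at_imp_continuous[OF holo_imp_cdiff] by (simp add: isCont_def tendsto_at_iff_tendsto_nhds)

lemma holo_ball:
  assumes "holo h" obtains r where "r > 0" "\<And>x. x \<in> ball 0 r \<Longrightarrow> cdiff_at h x"
  using assms unfolding holo_def eventually_nhds_metric by (auto simp: dist_commute)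

lemma holo_const [intro, simp]: "holo (\<lambda>_. c)"
  by (simp add: holo_def cdiff_at_const)

lemma holo_nth [intro, simp]: "holo (\<lambda>z. z $ i)"
  by (simp add: holo_def cdiff_at_nth)

lemma holo_add [intro]: "holo f \<Longrightarrow> holo g \<Longrightarrow> holo (\<lambda>z. f z + g z)"
  unfolding holo_def by (erule (1) eventually_elim2) (rule cdiff_at_add)

lemma holo_diff [intro]: "holo f \<Longrightarrow> holo g \<Longrightarrow> holo (\<lambda>z. f z - g z)"
  unfolding holo_def by (erule (1) eventually_elim2) (rule cdiff_at_diff)

lemma holo_mult [intro]: "holo f \<Longrightarrow> holo g \<Longrightarrow> holo (\<lambda>z. f z * g z)"
  unfolding holo_def by (erule (1) eventually_elim2) (rule cdiff_at_mult)

lemma holo_power [intro]: "holo f \<Longrightarrow> holo (\<lambda>z. f z ^ n)"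
  by (induction n) auto

lemma holo_sum [intro]: "(\<And>i. i \<in> I \<Longrightarrow> holo (f i)) \<Longrightarrow> holo (\<lambda>z. \<Sum>i\<in>I. f i z)"
  by (induction I rule: infinite_finite_induct) auto

lemma holo_prod [intro]: "(\<And>i. i \<in> I \<Longrightarrow> holo (f i)) \<Longrightarrow> holo (\<lambda>z. \<Prod>i\<in>I. f i z)"
  by (induction I rule: infinite_finite_induct) auto

lemma holo_transform:
  assumes "holo f" "\<forall>\<^sub>F z in nhds 0. f z = g z"
  shows "holo g"
proof -
  have "\<forall>\<^sub>F x in nhds 0. \<forall>\<^sub>F z in nhds x. f z = g z"
    using assms(2) by (simp add: eventually_eventually)
  then show ?thesis
    using assms(1) unfolding holo_def by eventually_elim (rule cdiff_at_transform)
qed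

lemma filterlim_germ:
  fixes G :: "complex ^ 'm \<Rightarrow> complex ^ 'n"
  assumes "\<And>j. holo (\<lambda>z. G z $ j)" "G 0 = 0"
  shows "filterlim G (nhds 0) (nhds 0)"
proof (rule vec_tendstoI)
  show "((\<lambda>z. G z $ j) \<longlongrightarrow> 0 $ j) (nhds 0)" for j
    using holo_tendsto[OF assms(1), of j] assms(2) by simp
qed

lemma holo_compose:
  fixes G :: "complex ^ 'm \<Rightarrow> complex ^ 'n"
  assumes "holo h" and G: "\<And>j. holo (\<lambda>z. G z $ j)" and "G 0 = 0"
  shows "holo (\<lambda>z. h (G z))"
proof -
  have "\<forall>\<^sub>F z in nhds 0. cdiff_at h (G z)"
    using assms(1) filterlim_germ[OF G \<open>G 0 = 0\<close>] unfolding holo_def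
    by (rule eventually_compose_filterlim)
  moreover have "\<forall>\<^sub>F z in nhds 0. \<forall>j. cdiff_at (\<lambda>z. G z $ j) z"
    using G unfolding holo_def by (rule eventually_all_finite)
  ultimately show ?thesis
    unfolding holo_def by eventually_elim (rule cdiff_at_compose, auto)
qed

lemma holo_compose_univariate:
  assumes "\<forall>\<^sub>F t in nhds (q 0). p field_differentiable (at t)" and q: "holo q"
  shows "holo (\<lambda>z. p (q z))"
proof -
  have "\<forall>\<^sub>F z in nhds 0. p field_differentiable (at (q z))"
    using assms(1) holo_tendsto[OF q] by (rule eventually_compose_filterlim)
  then show ?thesis
    using q unfolding holo_def by eventually_elim (rule cdiff_at_compose_univariate)
qed

section \<open>Removable singularities and division by a coordinate\<close>

text \<open>By Osgood's lemma only slices through points of the hyperplane matter. A slice in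
  direction \<open>i\<close> meets it in one point, an isolated singularity of a continuous
  function. Any other slice lies inside it and is a uniform limit of parallel slices that avoid
  it.\<close>

lemma cdiff_removable_singularity:
  fixes k :: "complex ^ 'n \<Rightarrow> complex"
  assumes "open U" and cont: "continuous_on U k"
    and diff: "\<And>x. x \<in> U \<Longrightarrow> x $ i \<noteq> 0 \<Longrightarrow> cdiff_at k x"
    and "x \<in> U"
  shows "cdiff_at k x"
proof (rule Osgood[OF \<open>open U\<close> cont _ \<open>x \<in> U\<close>])
  fix x j assume "x \<in> U"
  show "(\<lambda>t. k (x + t *s axis j 1)) field_differentiable at 0"
  proof (cases "x $ i = 0")
    case False
    then show ?thesis
      using diff[OF \<open>x \<in> U\<close>] by (intro cdiff_at_slice) (simp add: vector_smult_lzero)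
  next
    case True
    obtain r0 where r0: "r0 > 0" "cball x r0 \<subseteq> U"
      using \<open>open U\<close> \<open>x \<in> U\<close> open_contains_cball by blast
    define r where "r = r0 / 2"
    have r: "r > 0" "cball x (2 * r) \<subseteq> U" using r0 by (auto simp: r_def)
    then have r1: "cball x r \<subseteq> U" using subset_cball[of r "2 * r" x] by auto
    have "(\<lambda>t. k (x + t *s axis j 1)) holomorphic_on ball 0 r"
    proof (cases "j = i")
      case True
      show ?thesis
      proof (rule no_isolated_singularity[where K = "{0}"])
        show "continuous_on (ball 0 r) (\<lambda>t. k (x + t *s axis j 1))"
          using continuous_on_slice[OF cont r1] continuous_on_subset ball_subset_cball by blast
        show "(\<lambda>t. k (x + t *s axis j 1)) holomorphic_on ball 0 r - {0}"
        proof (rule holomorphic_onI)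
          fix t :: complex assume t: "t \<in> ball 0 r - {0}"
          have "cdiff_at k (x + t *s axis j 1)"
          proof (rule diff)
            show "x + t *s axis j 1 \<in> U" using t r1 cball_axis[of t r x j] by auto
            show "(x + t *s axis j 1) $ i \<noteq> 0" using t \<open>x $ i = 0\<close> \<open>j = i\<close> by simp
          qed
          then show "(\<lambda>t. k (x + t *s axis j 1)) field_differentiable at t within ball 0 r - {0}"
            by (intro field_differentiable_at_within[OF cdiff_at_slice])
        qed
      qed auto
    next
      case False
      \<comment> \<open>The slice is pushed off the hyperplane by \<open>r / (n + 1)\<close>; with
        \<open>norm t \<le> r\<close> it stays in the ball of radius \<open>2 * r\<close>.\<close>
      define p where "p = (\<lambda>n t. (x + (of_real (r / real (Suc n)) :: complex) *s axis i 1) + t *s axis j 1)"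
      have pU: "p n t \<in> cball x (2 * r)" if "t \<in> cball 0 r" for n t
      proof -
        have "norm ((of_real (r / real (Suc n)) :: complex) *s axis i 1 + t *s axis j 1) \<le> r + r"
          by (rule norm_triangle_mono)
            (use that r in \<open>auto simp: divide_le_eq mult_le_cancel_left1 simp del: of_nat_Suc of_real_divide\<close>)
        moreover have "dist (p n t) x = norm ((of_real (r / real (Suc n)) :: complex) *s axis i 1 + t *s axis j 1)"
          by (simp add: p_def dist_norm del: of_nat_Suc of_real_divide)
        ultimately show ?thesis by (simp add: dist_commute)
      qed
      have uc: "uniformly_continuous_on (cball x (2 * r)) k"
        by (rule compact_uniformly_continuous) (use cont r continuous_on_subset in auto)
      have "(\<lambda>n. r / real (Suc n)) \<longlonglongrightarrow> 0" by real_asymp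
      have "uniform_limit (cball 0 r) (\<lambda>n t. k (p n t)) (\<lambda>t. k (x + t *s axis j 1)) sequentially"
      proof (rule uniform_limitI)
        fix e :: real assume "e > 0"
        with uc obtain d where d: "d > 0"
          "\<And>y z. y \<in> cball x (2 * r) \<Longrightarrow> z \<in> cball x (2 * r) \<Longrightarrow> dist z y < d \<Longrightarrow> dist (k z) (k y) < e"
          unfolding uniformly_continuous_on_def by metis
        have "\<forall>\<^sub>F n in sequentially. r / real (Suc n) < d"
          using \<open>(\<lambda>n. r / real (Suc n)) \<longlonglongrightarrow> 0\<close> d(1) by (rule order_tendstoD)
        then show "\<forall>\<^sub>F n in sequentially. \<forall>t\<in>cball 0 r. dist (k (p n t)) (k (x + t *s axis j 1)) < e"
        proof eventually_elim
          case (elim n)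
          show ?case
          proof
            fix t :: complex assume t: "t \<in> cball 0 r"
            show "dist (k (p n t)) (k (x + t *s axis j 1)) < e"
            proof (rule d(2))
              show "x + t *s axis j 1 \<in> cball x (2 * r)"
                using cball_axis[OF t, of x j] r by auto
              have "p n t - (x + t *s axis j 1) = (of_real (r / real (Suc n)) :: complex) *s axis i 1"
                by (simp add: p_def)
              then show "dist (p n t) (x + t *s axis j 1) < d"
                using elim r unfolding dist_norm by (simp del: of_nat_Suc of_real_divide)
            qed (rule pU[OF t])
          qed
        qed
      qed
      moreover have "continuous_on (cball 0 r) (\<lambda>t. k (p n t)) \<and> (\<lambda>t. k (p n t)) holomorphic_on ball 0 r" for n
      proof
        have fd: "(\<lambda>t. k (p n t)) field_differentiable (at t)" if "t \<in> cball 0 r" for t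
          unfolding p_def
        proof (rule cdiff_at_slice, rule diff)
          show "x + (of_real (r / real (Suc n)) :: complex) *s axis i 1 + t *s axis j 1 \<in> U"
            using pU[OF that, of n] r unfolding p_def by blast
          show "(x + (of_real (r / real (Suc n)) :: complex) *s axis i 1 + t *s axis j 1) $ i \<noteq> 0"
            using True False r by (simp add: axis_def del: of_nat_Suc)
        qed
        show "continuous_on (cball 0 r) (\<lambda>t. k (p n t))"
          using fd by (intro continuous_at_imp_continuous_on ballI field_differentiable_imp_continuous_at)
        show "(\<lambda>t. k (p n t)) holomorphic_on ball 0 r"
          using fd by (simp add: holomorphic_on_def field_differentiable_at_within)
      qed
      ultimately show ?thesis
        by - (rule holomorphic_uniform_limit[OF always_eventually _ sequentially_bot], simp_all)
    qed
    then show ?thesis using r by (auto simp: holomorphic_on_imp_differentiable_at)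
  qed
qed

lemma restr_remove: "restr (- {i}) z = z - (z $ i) *s axis i 1"
  by (auto simp: vec_eq_iff restr_def axis_def)

lemma cdiff_at_restr: "cdiff_at (\<lambda>z. restr S z $ j) x"
  by (cases "j \<in> S") (simp_all add: restr_def cdiff_at_const cdiff_at_nth)

lemma holo_restr [intro]:
  assumes "holo h" shows "holo (\<lambda>z. h (restr S z))"
  by (rule holo_compose[OF assms]) (simp_all add: holo_def cdiff_at_restr, simp add: restr_def vec_eq_iff)

text \<open>The quotient extends to the hyperplane by the partial derivative. The mean value
  estimate along the \<open>i\<close>-th slice shows that this extension is continuous, and the
  removable singularity lemma does the rest.\<close>

lemma holo_divide_coordinate:
  fixes h :: "complex ^ 'n \<Rightarrow> complex"
  assumes "holo h"
  obtains k where "holo k" "\<And>z. h z = h (restr (- {i}) z) + z $ i * k z"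
proof -
  \<comment> \<open>On the hyperplane the factor \<open>z $ i\<close> annihilates \<open>k\<close>,
    so the division identity holds at every point, not only near \<open>0\<close>.\<close>
  define k where "k = (\<lambda>z. if z $ i = 0 then cpartial i h z else (h z - h (restr (- {i}) z)) / z $ i)"
  have eq: "h z = h (restr (- {i}) z) + z $ i * k z" for z
    by (cases "z $ i = 0") (auto simp: k_def restr_remove)
  obtain r where r: "r > 0" "\<And>x. x \<in> ball 0 r \<Longrightarrow> cdiff_at h x"
    using assms by (rule holo_ball) blast
  have contD: "continuous_on (ball 0 r) (cpartial i h)"
    by (rule continuous_on_cpartial[OF open_ball cdiff_on_imp_continuous_on[OF r(2)]])
      (auto intro!: cdiff_at_slice r simp: vector_smult_lzero)
  have kdiff: "cdiff_at k x" if "x \<in> ball 0 r" "x $ i \<noteq> 0" for x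
  proof (rule cdiff_at_transform)
    have "restr (- {i}) x \<in> ball 0 r"
      using that norm_restr_le[of "- {i}" x] by simp
    then have "cdiff_at (\<lambda>z. h (restr (- {i}) z)) x"
      by (rule cdiff_at_compose[OF r(2)]) (rule cdiff_at_restr)
    then show "cdiff_at (\<lambda>z. (h z - h (restr (- {i}) z)) * inverse (z $ i)) x"
      using that(2) cdiff_at_diff[OF r(2)[OF that(1)]]
      by (intro cdiff_at_mult cdiff_at_compose_univariate[where p = inverse] cdiff_at_nth)
        (simp_all add: field_differentiable_inverse field_differentiable_ident)
    have "((\<lambda>z. z $ i) \<longlongrightarrow> x $ i) (nhds x)"
      by (intro tendsto_vec_nth filterlim_ident)
    then have "\<forall>\<^sub>F z in nhds x. z $ i \<noteq> 0"
      using \<open>x $ i \<noteq> 0\<close> by (rule tendsto_imp_eventually_ne)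
    then show "\<forall>\<^sub>F z in nhds x. (h z - h (restr (- {i}) z)) * inverse (z $ i) = k z"
      by eventually_elim (simp add: k_def divide_inverse)
  qed
  have kcont: "continuous_on (ball 0 r) k"
  proof (rule continuous_at_imp_continuous_on, rule ballI)
    fix z0 :: "complex ^ 'n" assume z0: "z0 \<in> ball 0 r"
    show "isCont k z0"
    proof (cases "z0 $ i = 0")
      case False
      then show ?thesis using kdiff[OF z0] cdiff_at_imp_continuous by blast
    next
      case True
      show ?thesis
        unfolding continuous_at_eps_delta
      proof (intro allI impI)
        fix e :: real assume "e > 0"
        have "isCont (cpartial i h) z0"
          using contD z0 by (simp add: continuous_on_eq_continuous_at)
        then obtain d1 where d1: "d1 > 0"
          "\<And>z. dist z z0 < d1 \<Longrightarrow> dist (cpartial i h z) (cpartial i h z0) < e / 2"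
          unfolding continuous_at_eps_delta using half_gt_zero[OF \<open>e > 0\<close>] by blast
        obtain d2 where d2: "d2 > 0" "ball z0 d2 \<subseteq> ball 0 r"
          using z0 open_contains_ball[of "ball 0 r"] by blast
        show "\<exists>d>0. \<forall>z. dist z z0 < d \<longrightarrow> dist (k z) (k z0) < e"
        \<comment> \<open>The slice used for \<open>z\<close> stays within three times
          \<open>dist z z0\<close> of \<open>z0\<close>: once for \<open>z\<close> itself, and at
          most twice for \<open>t - z $ i\<close>.\<close>
        proof (intro exI[of _ "min d1 d2 / 3"] conjI allI impI)
          fix z assume z: "dist z z0 < min d1 d2 / 3"
          show "dist (k z) (k z0) < e"
          proof (cases "z $ i = 0")
            case True
            then show ?thesis
              using d1(2)[of z] z d1(1) \<open>z0 $ i = 0\<close> \<open>e > 0\<close> by (simp add: k_def)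
          next
            case False
            define x where "x = restr (- {i}) z"
            define F where "F = (\<lambda>t. h (x + t *s axis i 1) - cpartial i h z0 * t)"
            have zi: "norm (z $ i) \<le> dist z z0"
              using Finite_Cartesian_Product.norm_nth_le[of "z - z0" i] True by (simp add: dist_norm)
            have close: "dist (x + t *s axis i 1) z0 < min d1 d2" if "t \<in> cball 0 (norm (z $ i))" for t
            proof -
              have "x + t *s axis i 1 - z0 = (z - z0) + ((t - z $ i) *s axis i 1)"
                by (simp add: x_def restr_remove vec_eq_iff algebra_simps)
              then have "dist (x + t *s axis i 1) z0 \<le> dist z z0 + norm (t - z $ i)"
                using norm_triangle_ineq[of "z - z0" "(t - z $ i) *s axis i 1"]
                by (simp only: dist_norm norm_axis_scale)
              also have "\<dots> < min d1 d2"
                using z zi that norm_triangle_ineq4[of t "z $ i"] by simp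
              finally show ?thesis .
            qed
            have "norm (F (z $ i) - F 0) \<le> e / 2 * norm (z $ i - 0)"
            proof (rule field_differentiable_bound[where S = "cball 0 (norm (z $ i))" and
                  f' = "\<lambda>t. cpartial i h (x + t *s axis i 1) - cpartial i h z0"])
              fix t :: complex assume t: "t \<in> cball 0 (norm (z $ i))"
              have "x + t *s axis i 1 \<in> ball 0 r" using close[OF t] d2 by (auto simp: dist_commute)
              then have "cdiff_at h ((x + t *s axis i 1) + 0 *s axis i 1)"
                using r(2) by (simp add: vector_smult_lzero)
              note slice_shift[OF cdiff_at_slice[OF this]]
              from DERIV_diff[OF this DERIV_cmult_Id]
              show "(F has_field_derivative cpartial i h (x + t *s axis i 1) - cpartial i h z0) (at t within cball 0 (norm (z $ i)))"
                unfolding F_def by (rule has_field_derivative_at_within)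
              show "norm (cpartial i h (x + t *s axis i 1) - cpartial i h z0) \<le> e / 2"
                using d1(2)[of "x + t *s axis i 1"] close[OF t] by (simp add: dist_norm)
            qed simp_all
            moreover have "F (z $ i) - F 0 = z $ i * (k z - k z0)"
            proof -
              have "x + (z $ i) *s axis i 1 = z" by (simp add: x_def restr_remove)
              then have "F (z $ i) - F 0 = h z - h x - cpartial i h z0 * z $ i"
                by (simp add: F_def vector_smult_lzero)
              also have "h z - h x = z $ i * k z" using eq[of z] by (simp add: x_def)
              also have "cpartial i h z0 = k z0" using True by (simp add: k_def)
              finally show ?thesis by (simp add: algebra_simps)
            qed
            ultimately have "norm (z $ i) * norm (k z - k z0) \<le> norm (z $ i) * (e / 2)"
              by (simp add: norm_mult mult.commute)
            then have "norm (k z - k z0) \<le> e / 2"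
              using False by (simp add: mult_le_cancel_left_pos)
            then show ?thesis using \<open>e > 0\<close> by (simp add: dist_norm)
          qed
        qed (use d1 d2 in simp)
      qed
    qed
  qed
  have "cdiff_at k x" if "x \<in> ball 0 r" for x
    using cdiff_removable_singularity[OF open_ball kcont kdiff that] .
  then have "holo k"
    unfolding holo_def eventually_nhds_metric using r(1) by (auto simp: dist_commute)
  with eq show ?thesis using that by blast
qed

section \<open>Order of vanishing\<close>

text \<open>A growth bound instead of a condition on Taylor coefficients: it survives restriction to
  coordinate subspaces and loses one order under division by a coordinate.\<close>

definition vanishes :: "nat \<Rightarrow> (complex ^ 'n \<Rightarrow> complex) \<Rightarrow> bool" where
  "vanishes s h \<longleftrightarrow> (\<exists>C. \<forall>\<^sub>F z in nhds 0. norm (h z) \<le> C * norm z ^ s)"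

lemma vanishes_zero:
  assumes "holo h" shows "vanishes 0 h"
proof -
  have "\<forall>\<^sub>F z in nhds 0. norm (h z) < norm (h 0) + 1"
    using tendsto_norm[OF holo_tendsto[OF assms]] by (rule order_tendstoD) simp
  then show ?thesis
    unfolding vanishes_def by (intro exI[of _ "norm (h 0) + 1"]) (auto elim: eventually_mono)
qed

lemma vanishes_mono:
  assumes "vanishes s h" "s' \<le> s" shows "vanishes s' h"
proof -
  obtain C where C: "\<forall>\<^sub>F z in nhds 0. norm (h z) \<le> C * norm z ^ s"
    using assms by (auto simp: vanishes_def)
  have "\<forall>\<^sub>F z :: complex ^ 'a in nhds 0. norm z < 1"
    using eventually_nhds_in_open[of "ball 0 1" "0 :: complex ^ 'a"] by (simp add: eventually_mono)
  with C have "\<forall>\<^sub>F z in nhds 0. norm (h z) \<le> \<bar>C\<bar> * norm z ^ s'"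
  proof eventually_elim
    case (elim z)
    have "norm (h z) \<le> \<bar>C\<bar> * norm z ^ s"
      using elim(1) mult_right_mono[OF abs_ge_self[of C], of "norm z ^ s"] by simp
    also have "\<dots> \<le> \<bar>C\<bar> * norm z ^ s'"
      using elim(2) assms(2) by (intro mult_left_mono power_decreasing) auto
    finally show ?case .
  qed
  then show ?thesis unfolding vanishes_def by blast
qed

lemma vanishes_restr:
  assumes "vanishes s h" shows "vanishes s (\<lambda>z. h (restr S z))"
proof -
  obtain C where C: "\<forall>\<^sub>F z in nhds 0. norm (h z) \<le> C * norm z ^ s"
    using assms by (auto simp: vanishes_def)
  have "filterlim (restr S) (nhds 0) (nhds (0 :: complex ^ 'a))"
    by (rule filterlim_germ) (simp_all add: holo_def cdiff_at_restr, simp add: restr_def vec_eq_iff)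
  from eventually_compose_filterlim[OF C this]
  have "\<forall>\<^sub>F z in nhds 0. norm (h (restr S z)) \<le> \<bar>C\<bar> * norm z ^ s"
  proof eventually_elim
    case (elim z)
    also have "C * norm (restr S z) ^ s \<le> \<bar>C\<bar> * norm z ^ s"
      by (intro mult_mono power_mono norm_restr_le) auto
    finally show ?case .
  qed
  then show ?thesis unfolding vanishes_def by blast
qed

lemma restr_restr: "restr S (restr T z) = restr (S \<inter> T) z"
  by (simp add: restr_def vec_eq_iff)

text \<open>By the maximum principle in the \<open>i\<close>-th variable it suffices to bound the quotient where
  \<open>\<bar>z $ i\<bar>\<close> is comparable to \<open>\<bar>z\<bar>\<close>.\<close>

lemma vanishes_divide_coordinate:
  fixes h :: "complex ^ 'n \<Rightarrow> complex"
  assumes "holo k" and eq: "\<And>z. h z = h (restr (- {i}) z) + z $ i * k z"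
    and "vanishes (Suc s) h"
  shows "vanishes s k"
proof -
  obtain C0 where C0: "\<forall>\<^sub>F z in nhds 0. norm (h z) \<le> C0 * norm z ^ Suc s"
    using assms(3) by (auto simp: vanishes_def)
  with \<open>holo k\<close> have "\<forall>\<^sub>F z in nhds 0. cdiff_at k z \<and> norm (h z) \<le> C0 * norm z ^ Suc s"
    unfolding holo_def by (rule eventually_conj)
  then obtain r where r: "r > 0" "\<And>z. norm z < r \<Longrightarrow> cdiff_at k z"
    "\<And>z. norm z < r \<Longrightarrow> norm (h z) \<le> C0 * norm z ^ Suc s"
    unfolding eventually_nhds_metric by auto
  define C where "C = \<bar>C0\<bar>"
  have C: "norm (h z) \<le> C * norm z ^ Suc s" if "norm z < r" for z
    using r(3)[OF that] mult_right_mono[OF abs_ge_self[of C0], of "norm z ^ Suc s"] by (simp add: C_def)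
  have "C \<ge> 0" by (simp add: C_def)
  \<comment> \<open>Two values of \<open>h\<close>, each at most \<open>C * (2 * R) ^ Suc s\<close>,
    divided by \<open>R\<close>.\<close>
  define D where "D = C * 2 ^ (s + 2)"
  have bound: "norm (k z) \<le> D * norm z ^ s" if z: "norm z < r / 2" "z \<noteq> 0" for z
  proof -
    define x where "x = restr (- {i}) z"
    define R where "R = norm z"
    have R: "R > 0" "R < r / 2" using z by (auto simp: R_def)
    have xR: "norm x \<le> R" by (simp add: x_def R_def norm_restr_le)
    have near: "norm (x + t *s axis i 1) \<le> 2 * R" if "t \<in> cball 0 R" for t
      using norm_triangle_mono[OF xR, of "t *s axis i 1" R] that by simp
    have fd: "(\<lambda>t. k (x + t *s axis i 1)) field_differentiable (at t)" if "t \<in> cball 0 R" for t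
      by (intro cdiff_at_slice r) (use near[OF that] R in simp)
    have "norm (k (x + (z $ i) *s axis i 1)) \<le> D * R ^ s"
    proof (rule maximum_modulus_frontier[where S = "cball 0 R" and f = "\<lambda>t. k (x + t *s axis i 1)"])
      show "(\<lambda>t. k (x + t *s axis i 1)) holomorphic_on interior (cball 0 R)"
        using fd by (simp add: holomorphic_on_def field_differentiable_at_within)
      show "continuous_on (closure (cball 0 R)) (\<lambda>t. k (x + t *s axis i 1))"
        using fd by (auto intro!: continuous_at_imp_continuous_on field_differentiable_imp_continuous_at)
      fix t :: complex assume "t \<in> frontier (cball 0 R)"
      then have t: "norm t = R" using R by (simp add: frontier_cball)
      define p where "p = x + t *s axis i 1"
      have p: "norm p \<le> 2 * R" unfolding p_def using near t by simp
      have pi: "p $ i = t" by (simp add: p_def x_def restr_def)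
      have hp: "norm (h q) \<le> C * (2 * R) ^ Suc s" if "norm q \<le> 2 * R" for q
      proof -
        have "norm (h q) \<le> C * norm q ^ Suc s" using that R by (intro C) simp
        also have "\<dots> \<le> C * (2 * R) ^ Suc s"
          using that \<open>C \<ge> 0\<close> by (intro mult_left_mono power_mono) auto
        finally show ?thesis .
      qed
      have "R * norm (k p) = norm (h p - h (restr (- {i}) p))"
        using eq[of p] pi t by (simp add: norm_mult)
      also have "\<dots> \<le> C * (2 * R) ^ Suc s + C * (2 * R) ^ Suc s"
        by (rule order.trans[OF norm_triangle_ineq4 add_mono[OF hp[OF p] hp[OF order.trans[OF norm_restr_le p]]]])
      also have "\<dots> = R * (D * R ^ s)" by (simp add: D_def power_mult_distrib)
      finally show "norm (k (x + t *s axis i 1)) \<le> D * R ^ s"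
        using R by (simp add: p_def)
    qed (use Finite_Cartesian_Product.norm_nth_le[of z i] in \<open>auto simp: R_def\<close>)
    then show ?thesis by (simp add: x_def R_def restr_remove)
  qed
  have at0: "\<forall>\<^sub>F z in at 0. norm (k z) \<le> D * norm z ^ s"
    unfolding eventually_at using bound r(1) by (intro exI[of _ "r / 2"]) auto
  \<comment> \<open>The disc degenerates at \<open>z = 0\<close>, so the bound passes to this point
    by continuity. For \<open>s = 0\<close> it reads \<open>norm (k 0) \<le> D\<close>, since
    \<open>0 ^ 0 = 1\<close>.\<close>
  have "norm (k 0) \<le> D * norm (0 :: complex ^ 'n) ^ s"
  proof (rule tendsto_le[OF _ _ _ at0])
    show "((\<lambda>z :: complex ^ 'n. D * norm z ^ s) \<longlongrightarrow> D * norm (0 :: complex ^ 'n) ^ s) (at 0)"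
      by (intro tendsto_intros)
    have "isCont k 0"
      by (rule cdiff_at_imp_continuous[OF holo_imp_cdiff[OF \<open>holo k\<close>]])
    then show "((\<lambda>z. norm (k z)) \<longlongrightarrow> norm (k 0)) (at 0)"
      unfolding isCont_def by (rule tendsto_norm)
  qed simp
  then have "norm (k z) \<le> D * norm z ^ s" if "norm z < r / 2" for z
    using bound[OF that] by (cases "z = 0") auto
  then have "\<forall>\<^sub>F z in nhds 0. norm (k z) \<le> D * norm z ^ s"
    unfolding eventually_nhds_metric using r(1) by (intro exI[of _ "r / 2"]) auto
  then show ?thesis unfolding vanishes_def by blast
qed

section \<open>Monomial ideals and expansion in one coordinate\<close>

text \<open>This is the pigeonhole principle for monomials, carried out by division. Splitting off
  coordinate \<open>i\<close> leaves a restriction with one variable fewer and the same order, and a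
  quotient whose order and required exponent \<open>e i\<close> both drop by one. In either case the
  strict inequality between exponents and order persists.\<close>

lemma monomial_ideal:
  fixes h :: "complex ^ 'n \<Rightarrow> complex"
  assumes "holo h" "\<And>z. h (restr S z) = h z" "vanishes s h" "sum e S < s"
  shows "\<exists>u. (\<forall>i\<in>S. holo (u i)) \<and> (\<forall>\<^sub>F z in nhds 0. h z = (\<Sum>i\<in>S. (z $ i) ^ e i * u i z))"
  using assms
proof (induction "card S + sum e S" arbitrary: S s e h rule: less_induct)
  case less
  have fin: "finite S" by simp
  consider "S = {}" | i where "i \<in> S" "e i = 0" | i e' where "i \<in> S" "e i = Suc e'"
    by (metis all_not_in_conv not0_implies_Suc)
  then show ?case
  proof cases
    \<comment> \<open>Without variables \<open>h\<close> is constant, and its order \<open>s\<close>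
      is positive.\<close>
    case 1
    obtain C where "\<forall>\<^sub>F z in nhds 0. norm (h z) \<le> C * norm z ^ s"
      using less.prems(3) by (auto simp: vanishes_def)
    from eventually_nhds_x_imp_x[OF this] have "h 0 = 0"
      using less.prems(4) by (simp add: power_0_left)
    moreover have "h z = h 0" for z
      using less.prems(2)[of z] by (simp add: 1 restr_def zero_vec_def)
    ultimately show ?thesis using 1 by simp
  next
    case (2 i)
    show ?thesis
    proof (intro exI[of _ "\<lambda>j. if j = i then h else (\<lambda>_. 0)"] conjI ballI always_eventually allI)
      show "h z = (\<Sum>j\<in>S. z $ j ^ e j * (if j = i then h else (\<lambda>_. 0)) z)" for z
      proof -
        have "(\<Sum>j\<in>S. z $ j ^ e j * (if j = i then h else (\<lambda>_. 0)) z) = (\<Sum>j\<in>S. if j = i then h z else 0)"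
          by (intro sum.cong) (auto simp: 2)
        then show ?thesis using 2 fin by simp
      qed
    qed (use less.prems in auto)
  next
    case (3 i e')
    obtain k where k: "holo k" "\<And>z. h z = h (restr (- {i}) z) + z $ i * k z"
      using holo_divide_coordinate[OF less.prems(1)] by blast
    have sumS: "sum e S = Suc (e' + sum e (S - {i}))"
      using 3 fin by (simp add: sum.remove)
    obtain s' where s': "s = Suc s'" using less.prems(4) by (cases s) auto
    define e2 where "e2 = e(i := e')"
    have sum2: "sum e2 S = e' + sum e (S - {i})"
      using 3 fin by (simp add: sum.remove e2_def)
    have IH1: "\<exists>u. (\<forall>j\<in>S - {i}. holo (u j)) \<and>
        (\<forall>\<^sub>F z in nhds 0. h (restr (- {i}) z) = (\<Sum>j\<in>S - {i}. (z $ j) ^ e j * u j z))"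
    proof (rule less.hyps)
      show "card (S - {i}) + sum e (S - {i}) < card S + sum e S"
        using 3 fin sumS card_Diff1_le[of S i] by simp
      show "holo (\<lambda>z. h (restr (- {i}) z))" using less.prems(1) by blast
      show "vanishes s (\<lambda>z. h (restr (- {i}) z))" using less.prems(3) by (rule vanishes_restr)
      show "h (restr (- {i}) (restr (S - {i}) z)) = h (restr (- {i}) z)" for z
      proof -
        have "- {i} \<inter> (S - {i}) = S \<inter> - {i}" by auto
        then show ?thesis
          using less.prems(2)[of "restr (- {i}) z"] by (simp add: restr_restr)
      qed
      show "sum e (S - {i}) < s" using less.prems(4) sumS by simp
    qed
    \<comment> \<open>The quotient \<open>k\<close> may depend on coordinates outside
      \<open>S\<close>; restricting it restores the invariance that the induction needs.\<close>
    have IH2: "\<exists>u. (\<forall>j\<in>S. holo (u j)) \<and>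
        (\<forall>\<^sub>F z in nhds 0. k (restr S z) = (\<Sum>j\<in>S. (z $ j) ^ e2 j * u j z))"
    proof (rule less.hyps)
      show "card S + sum e2 S < card S + sum e S" by (simp add: sumS sum2)
      show "holo (\<lambda>z. k (restr S z))" using k(1) by blast
      show "vanishes s' (\<lambda>z. k (restr S z))"
        by (rule vanishes_restr, rule vanishes_divide_coordinate[OF k(1) k(2)])
          (use less.prems(3) s' in auto)
      show "k (restr S (restr S z)) = k (restr S z)" for z by (simp add: restr_restr)
      show "sum e2 S < s'" using less.prems(4) sumS sum2 s' by simp
    qed
    from IH1 obtain u where u: "\<And>j. j \<in> S - {i} \<Longrightarrow> holo (u j)"
      "\<forall>\<^sub>F z in nhds 0. h (restr (- {i}) z) = (\<Sum>j\<in>S - {i}. (z $ j) ^ e j * u j z)" by blast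
    from IH2 obtain v where v: "\<And>j. j \<in> S \<Longrightarrow> holo (v j)"
      "\<forall>\<^sub>F z in nhds 0. k (restr S z) = (\<Sum>j\<in>S. (z $ j) ^ e2 j * v j z)" by blast
    \<comment> \<open>The factor \<open>z $ i\<close> from the division raises the exponent
      \<open>e'\<close> back to \<open>e i\<close> in the \<open>i\<close>-th term and is absorbed
      into the coefficients of the others.\<close>
    define w where "w = (\<lambda>j. if j = i then v i else (\<lambda>z. u j z + z $ i * v j z))"
    have "holo (w j)" if "j \<in> S" for j
    proof (cases "j = i")
      case False
      then have "holo (\<lambda>z. u j z + z $ i * v j z)"
        using u(1)[of j] v(1)[OF that] that by (intro holo_add holo_mult holo_nth) auto
      then show ?thesis using False by (simp add: w_def)
    qed (use v(1) 3 in \<open>simp add: w_def\<close>)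
    moreover have "\<forall>\<^sub>F z in nhds 0. h z = (\<Sum>j\<in>S. (z $ j) ^ e j * w j z)"
      using u(2) v(2)
    proof eventually_elim
      case (elim z)
      have eqs: "restr (- {i}) (restr S z) = restr S (restr (- {i}) z)"
        by (simp add: restr_restr Int_commute)
      have "h z = h (restr S z)" using less.prems(2) by simp
      also have "\<dots> = h (restr (- {i}) z) + z $ i * k (restr S z)"
        using 3 k(2)[of "restr S z"] less.prems(2)[of "restr (- {i}) z"]
        by (simp add: eqs) (simp add: restr_def)
      also have "\<dots> = (\<Sum>j\<in>S - {i}. (z $ j) ^ e j * u j z) + z $ i * (z $ i ^ e' * v i z + (\<Sum>j\<in>S - {i}. (z $ j) ^ e j * v j z))"
        using 3 fin by (simp add: elim sum.remove[of S i] e2_def)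
      also have "\<dots> = z $ i ^ e i * v i z + (\<Sum>j\<in>S - {i}. (z $ j) ^ e j * (u j z + z $ i * v j z))"
        using 3 by (simp add: algebra_simps sum.distrib sum_distrib_left)
      also have "\<dots> = (\<Sum>j\<in>S. (z $ j) ^ e j * w j z)"
        using 3 fin by (simp add: sum.remove[of S i] w_def)
      finally show ?case .
    qed
    ultimately show ?thesis by blast
  qed
qed

text \<open>Dividing the remainder again and again gives a finite Taylor expansion in the
  \<open>i\<close>-th variable with coefficients in the others.\<close>

lemma coordinate_expansion:
  assumes "holo h"
  shows "\<exists>q k. (\<forall>b. holo (q b)) \<and> holo k \<and>
    (\<forall>z. h z = (\<Sum>b<c. (z $ i) ^ b * q b (restr (- {i}) z)) + (z $ i) ^ c * k z)"
proof (induction c)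
  case 0
  show ?case by (rule exI[of _ "\<lambda>_ _. 0"], rule exI[of _ h]) (use assms in auto)
next
  case (Suc c)
  then obtain q k where qk: "\<And>b. holo (q b)" "holo k"
    "\<And>z. h z = (\<Sum>b<c. (z $ i) ^ b * q b (restr (- {i}) z)) + (z $ i) ^ c * k z" by blast
  obtain k' where k': "holo k'" "\<And>z. k z = k (restr (- {i}) z) + z $ i * k' z"
    using holo_divide_coordinate[OF qk(2)] by blast
  show ?case
  proof (intro exI conjI allI)
    \<comment> \<open>The old remainder itself serves as the new coefficient, because coefficients
      are evaluated only on the hyperplane.\<close>
    show "holo ((q(c := k)) b)" for b using qk by simp
    fix z
    have "h z = (\<Sum>b<c. (z $ i) ^ b * q b (restr (- {i}) z)) + (z $ i) ^ c * (k (restr (- {i}) z) + z $ i * k' z)"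
      using qk(3)[of z] k'(2)[of z] by simp
    then show "h z = (\<Sum>b<Suc c. (z $ i) ^ b * (q(c := k)) b (restr (- {i}) z)) + (z $ i) ^ Suc c * k' z"
      by (simp add: algebra_simps)
  qed (rule k'(1))
qed

section \<open>Jets\<close>

text \<open>The increment in direction \<open>i\<close> becomes a new variable, and the partial derivative is the quotient
  by this variable restricted to its zero set.\<close>

lemma holo_cpartial:
  fixes h :: "complex ^ 'n \<Rightarrow> complex"
  assumes "holo h"
  shows "holo (cpartial i h)"
proof -
  define G :: "complex ^ 'n option \<Rightarrow> complex ^ 'n" where
    "G = (\<lambda>w. \<chi> j. w $ Some j + (if j = i then w $ None else 0))"
  define E :: "complex ^ 'n \<Rightarrow> complex ^ 'n option" where
    "E = (\<lambda>z. \<chi> j. case j of None \<Rightarrow> 0 | Some j \<Rightarrow> z $ j)"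
  have "holo (\<lambda>w. h (G w))"
  proof (rule holo_compose[OF assms])
    show "holo (\<lambda>w. G w $ j)" for j
      by (cases "j = i") (auto simp: G_def)
  qed (simp add: G_def vec_eq_iff)
  then obtain k where k: "holo k" "\<And>w. h (G w) = h (G (restr (- {None}) w)) + w $ None * k w"
    using holo_divide_coordinate[of "\<lambda>w. h (G w)" None] by blast
  have Ej: "holo (\<lambda>z. E z $ j)" for j by (cases j) (auto simp: E_def)
  have E0: "E 0 = 0" by (auto simp: E_def vec_eq_iff split: option.splits)
  have "\<forall>\<^sub>F z in nhds 0. cdiff_at k (E z)"
    using k(1) filterlim_germ[OF Ej E0] unfolding holo_def by (rule eventually_compose_filterlim)
  then have ev: "\<forall>\<^sub>F z in nhds 0. k (E z) = cpartial i h z"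
  proof eventually_elim
    case (elim z)
    let ?w = "\<lambda>t. E z + t *s axis None 1"
    have 1: "G (?w t) = z + t *s axis i 1" for t
      by (simp add: G_def E_def vec_eq_iff axis_def)
    have "restr (- {None}) (?w t) = E z" for t
      by (auto simp: restr_def E_def vec_eq_iff axis_def split: option.splits)
    moreover have "G (E z) = z" by (simp add: G_def E_def vec_eq_iff)
    moreover have "?w t $ None = t" for t by (simp add: E_def)
    ultimately have 2: "h (z + t *s axis i 1) = h z + t * k (?w t)" for t
      using k(2)[of "?w t"] by (simp add: 1)
    have w0: "?w 0 = E z" by (simp add: vector_smult_lzero)
    have "(\<lambda>t. k (?w t)) field_differentiable (at 0)"
      by (rule cdiff_at_slice) (use elim w0 in simp)
    then obtain d where "((\<lambda>t. k (?w t)) has_field_derivative d) (at 0)"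
      by (auto simp: field_differentiable_def)
    then have "((\<lambda>t. h z + t * k (?w t)) has_field_derivative 0 + (1 * k (?w 0) + d * 0)) (at 0)"
      by (intro DERIV_add DERIV_mult DERIV_const DERIV_ident)
    then have "deriv (\<lambda>t. h (z + t *s axis i 1)) 0 = k (E z)"
      unfolding 2 w0 by (simp add: DERIV_imp_deriv)
    then show ?case by (simp add: cpartial_def)
  qed
  show ?thesis
    by (rule holo_transform[OF holo_compose[OF k(1) Ej E0] ev])
qed

lemma holo_foldr_cpartial: "holo h \<Longrightarrow> holo (foldr cpartial js h)"
  by (induction js) (auto intro: holo_cpartial)

text \<open>A partial derivative at \<open>z\<close> sees values near \<open>z\<close>. Equality
  near \<open>0\<close> is therefore first spread to neighbourhoods of the nearby points, and the
  conclusion is again an equality near \<open>0\<close>, ready for the next derivative.\<close>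

lemma cpartial_cong:
  fixes f g :: "complex ^ 'n \<Rightarrow> complex"
  assumes "\<forall>\<^sub>F z in nhds 0. f z = g z"
  shows "\<forall>\<^sub>F z in nhds 0. cpartial i f z = cpartial i g z"
proof -
  have "\<forall>\<^sub>F z in nhds 0. \<forall>\<^sub>F w in nhds z. f w = g w"
    using assms by (simp add: eventually_eventually)
  then show ?thesis
  proof eventually_elim
    case (elim z)
    have "((\<lambda>t. z + t *s axis i 1) \<longlongrightarrow> z + 0 *s axis i (1 :: complex)) (nhds 0)"
      by (intro tendsto_intros filterlim_ident)
    then have "filterlim (\<lambda>t. z + t *s axis i 1) (nhds z) (nhds (0 :: complex))"
      by (simp add: vector_smult_lzero)
    from eventually_compose_filterlim[OF elim this]
    show ?case unfolding cpartial_def by (rule deriv_cong_ev) simp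
  qed
qed

lemma cpartial_diff:
  fixes f g :: "complex ^ 'n \<Rightarrow> complex"
  assumes "holo f" "holo g"
  shows "\<forall>\<^sub>F z in nhds 0. cpartial i (\<lambda>x. f x - g x) z = cpartial i f z - cpartial i g z"
  using assms unfolding holo_def
proof eventually_elim
  case (elim z)
  have "(\<lambda>t. h (z + t *s axis i 1)) field_differentiable (at 0)" if "cdiff_at h z" for h
    by (rule cdiff_at_slice) (use that in \<open>simp add: vector_smult_lzero\<close>)
  then show ?case unfolding cpartial_def using elim by (intro deriv_diff) auto
qed

lemma foldr_cpartial_diff:
  assumes "holo f" "holo g"
  shows "\<forall>\<^sub>F z in nhds 0. foldr cpartial js (\<lambda>x. f x - g x) z = foldr cpartial js f z - foldr cpartial js g z"
proof (induction js)
  case (Cons j js)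
  show ?case
    using cpartial_cong[OF Cons, of j] cpartial_diff[OF assms[THEN holo_foldr_cpartial], of j js js]
    by eventually_elim simp
qed simp

section \<open>From vanishing derivatives to growth bounds\<close>

text \<open>The mean value inequality on the ball of radius \<open>norm z\<close> contributes the
  additional factor \<open>norm z\<close>.\<close>

lemma vanishes_Suc:
  fixes h :: "complex ^ 'n \<Rightarrow> complex"
  assumes "holo h" "h 0 = 0" and D: "\<And>i. vanishes s (cpartial i h)"
  shows "vanishes (Suc s) h"
proof -
  obtain C where C: "\<And>i. \<forall>\<^sub>F z in nhds 0. norm (cpartial i h z) \<le> C i * norm z ^ s"
    using D unfolding vanishes_def by metis
  have "\<forall>\<^sub>F z in nhds 0. cdiff_at h z \<and> (\<forall>i. norm (cpartial i h z) \<le> C i * norm z ^ s)"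
    using assms(1) C unfolding holo_def by (intro eventually_conj eventually_all_finite)
  then obtain r where r: "r > 0" "\<And>z. norm z < r \<Longrightarrow> cdiff_at h z"
    "\<And>z i. norm z < r \<Longrightarrow> norm (cpartial i h z) \<le> C i * norm z ^ s"
    unfolding eventually_nhds_metric by auto
  define K where "K = (\<Sum>i\<in>UNIV. \<bar>C i\<bar>)"
  have "norm (h z) \<le> K * norm z ^ Suc s" if z: "norm z < r" for z
  proof -
    have "norm (h z - h 0) \<le> (K * norm z ^ s) * norm (z - 0)"
    proof (rule differentiable_bound[where S = "cball 0 (norm z)" and
          f' = "\<lambda>x v. \<Sum>i\<in>UNIV. cpartial i h x * v $ i"])
      fix x :: "complex ^ 'n" assume "x \<in> cball 0 (norm z)"
      then have x: "norm x \<le> norm z" by simp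
      show "(h has_derivative (\<lambda>v. \<Sum>i\<in>UNIV. cpartial i h x * v $ i)) (at x within cball 0 (norm z))"
        by (rule has_derivative_at_withinI, rule cdiff_at_cpartial, rule r) (use x z in simp)
      show "onorm (\<lambda>v. \<Sum>i\<in>UNIV. cpartial i h x * v $ i) \<le> K * norm z ^ s"
      proof (rule onorm_le)
        fix v :: "complex ^ 'n"
        have "norm (\<Sum>i\<in>UNIV. cpartial i h x * v $ i) \<le> (\<Sum>i\<in>UNIV. \<bar>C i\<bar> * norm z ^ s * norm v)"
        proof (rule order.trans[OF norm_sum sum_mono])
          fix i
          have "norm (cpartial i h x) \<le> C i * norm x ^ s" using x z by (intro r) simp
          also have "\<dots> \<le> \<bar>C i\<bar> * norm z ^ s" by (intro mult_mono power_mono x) auto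
          finally show "norm (cpartial i h x * v $ i) \<le> \<bar>C i\<bar> * norm z ^ s * norm v"
            unfolding norm_mult by (intro mult_mono Finite_Cartesian_Product.norm_nth_le) auto
        qed
        then show "norm (\<Sum>i\<in>UNIV. cpartial i h x * v $ i) \<le> K * norm z ^ s * norm v"
          by (simp add: K_def sum_distrib_right)
      qed
    qed auto
    then show ?thesis using assms(2) by (simp add: mult_ac)
  qed
  then have "\<forall>\<^sub>F z in nhds 0. norm (h z) \<le> K * norm z ^ Suc s"
    unfolding eventually_nhds_metric using r(1) by (intro exI[of _ r]) auto
  then show ?thesis unfolding vanishes_def by blast
qed

lemma vanishes_if_jet_zero:
  assumes "holo h" "\<And>js. length js \<le> r \<Longrightarrow> foldr cpartial js h 0 = 0"
  shows "vanishes (Suc r) h"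
  using assms
proof (induction r arbitrary: h)
  case 0
  then show ?case using 0(2)[of "[]"] by (intro vanishes_Suc vanishes_zero holo_cpartial) auto
next
  case (Suc r)
  show ?case
  proof (rule vanishes_Suc[OF Suc.prems(1)])
    show "h 0 = 0" using Suc.prems(2)[of "[]"] by simp
    fix i
    show "vanishes (Suc r) (cpartial i h)"
    proof (rule Suc.IH)
      show "holo (cpartial i h)" by (rule holo_cpartial[OF Suc.prems(1)])
      \<comment> \<open>\<open>foldr\<close> applies the last index of a list first, so the
        derivative along \<open>js\<close> of \<open>cpartial i h\<close> is the derivative of
        \<open>h\<close> along \<open>js @ [i]\<close>.\<close>
      show "foldr cpartial js (cpartial i h) 0 = 0" if "length js \<le> r" for js
        using Suc.prems(2)[of "js @ [i]"] that by simp
    qed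
  qed
qed

lemma same_jet_vanishes:
  fixes f g :: "complex ^ 'n \<Rightarrow> complex ^ 'p"
  assumes "holo (\<lambda>x. f x $ c)" "holo (\<lambda>x. g x $ c)" "same_jet r f g"
  shows "vanishes (Suc r) (\<lambda>x. g x $ c - f x $ c)"
proof (rule vanishes_if_jet_zero)
  show "holo (\<lambda>x. g x $ c - f x $ c)" using assms(2,1) by (rule holo_diff)
  show "foldr cpartial js (\<lambda>x. g x $ c - f x $ c) 0 = 0" if "length js \<le> r" for js
    using eventually_nhds_x_imp_x[OF foldr_cpartial_diff[OF assms(2,1), of js]] assms(3) that
    by (simp add: same_jet_def)
qed

section \<open>Descent along a power map\<close>

definition upd :: "'n \<Rightarrow> complex \<Rightarrow> complex ^ 'n \<Rightarrow> complex ^ 'n" where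
  "upd i t z = (\<chi> j. if j = i then t else z $ j)"

lemma upd_nth [simp]: "upd i t z $ j = (if j = i then t else z $ j)"
  by (simp add: upd_def)

lemma upd_upd [simp]: "upd i s (upd i t z) = upd i s z"
  and upd_same [simp]: "upd i (z $ i) z = z"
  by (simp_all add: vec_eq_iff)

lemma norm_upd_le: "norm (upd i t z) \<le> norm z + norm t"
proof -
  have "upd i t z = restr (- {i}) z + t *s axis i 1"
    by (auto simp: vec_eq_iff restr_def axis_def)
  then show ?thesis
    using norm_triangle_mono[OF norm_restr_le[of "- {i}" z], of "t *s axis i 1" "norm t"] by simp
qed

text \<open>The principal branch jumps across the cut, but its modulus is continuous. It is used
  only inside functions invariant under roots of unity, for which all branches agree.\<close>

definition proot :: "nat \<Rightarrow> complex \<Rightarrow> complex" where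
  "proot m t = (if t = 0 then 0 else exp (Ln t / of_nat m))"

lemma proot_power: "m > 0 \<Longrightarrow> proot m t ^ m = t"
  by (auto simp: proot_def exp_of_nat_mult[symmetric])

lemma norm_proot: "m > 0 \<Longrightarrow> norm (proot m t) = root m (norm t)"
  using proot_power[of m t] by (intro real_root_pos_unique[symmetric]) (auto simp: norm_power[symmetric])

text \<open>Evaluating \<open>W\<close> at any \<open>m\<close>-th root of \<open>z $ i\<close>
  gives the same value by invariance. Away from the hyperplane a holomorphic local branch may be
  taken; at the hyperplane the roots tend to \<open>0\<close>, which gives continuity, and the
  singularity is removable.\<close>

lemma descend_power:
  fixes W :: "complex ^ 'n \<Rightarrow> complex"
  assumes "holo W" "m > 0" and inv: "\<And>\<zeta> z. \<zeta> ^ m = 1 \<Longrightarrow> W (upd i (\<zeta> * z $ i) z) = W z"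
  obtains w where "holo w" "\<forall>\<^sub>F z in nhds 0. W z = w (upd i ((z $ i) ^ m) z)"
proof -
  obtain r where r: "r > 0" "\<And>z. z \<in> ball 0 r \<Longrightarrow> cdiff_at W z"
    using holo_ball[OF assms(1)] by blast
  define w where "w = (\<lambda>z. W (upd i (proot m (z $ i)) z))"
  have w: "w z = W (upd i y z)" if "y ^ m = z $ i" for y z
  proof (cases "y = 0")
    case True
    then have "z $ i = 0" using that \<open>m > 0\<close> by (simp add: power_0_left)
    then show ?thesis using True by (simp add: w_def proot_def)
  next
    case False
    define \<zeta> where "\<zeta> = proot m (z $ i) / y"
    have "\<zeta> ^ m = 1"
      using False that proot_power[OF \<open>m > 0\<close>, of "z $ i"] by (auto simp: \<zeta>_def power_divide)
    from inv[OF this, of "upd i y z"] show ?thesis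
      using False by (simp add: w_def \<zeta>_def)
  qed
  \<comment> \<open>Replacing the coordinate by a root adds at most the modulus of the root to the
    norm; each summand is kept below \<open>r / 2\<close>.\<close>
  define d where "d = min (r / 2) ((r / 2) ^ m)"
  have d: "d > 0" using r by (simp add: d_def)
  have near: "upd i y z \<in> ball 0 r" if "z \<in> ball 0 d" "y ^ m = z $ i" for y z
  proof -
    have "norm y ^ m = norm (z $ i)" using that(2) by (simp add: norm_power[symmetric])
    also have "\<dots> < (r / 2) ^ m"
      using Finite_Cartesian_Product.norm_nth_le[of z i] that(1) by (simp add: d_def)
    finally have "norm y < r / 2" by (rule power_less_imp_less_base) (use r in simp)
    then show ?thesis using norm_upd_le[of i y z] that(1) by (simp add: d_def)
  qed
  have wdiff: "cdiff_at w z0" if z0: "z0 \<in> ball 0 d" "z0 $ i \<noteq> 0" for z0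
  proof -
    \<comment> \<open>A local branch through a fixed root at \<open>z0\<close>: the logarithm is
      taken of a quotient close to \<open>1\<close>, away from its cut.\<close>
    define y where "y = (\<lambda>z. proot m (z0 $ i) * exp (Ln (z $ i / z0 $ i) / of_nat m))"
    have y0: "y z0 ^ m = z0 $ i"
      using z0 by (simp add: y_def proot_power \<open>m > 0\<close>)
    have "cdiff_at (\<lambda>z. upd i (y z) z $ j) z0" for j
    proof (cases "j = i")
      case True
      define a where "a = z0 $ i"
      have "((\<lambda>t. t / a) has_field_derivative 1 / a) (at a)"
        by (rule DERIV_cdivide[OF DERIV_ident])
      moreover have "(Ln has_field_derivative inverse (a / a)) (at (a / a))"
        by (rule has_field_derivative_Ln) (use z0(2) in \<open>simp add: a_def\<close>)
      ultimately have "((\<lambda>t. Ln (t / a)) has_field_derivative inverse (a / a) * (1 / a)) (at a)"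
        by (rule DERIV_chain2[rotated])
      from DERIV_cmult[OF DERIV_fun_exp[OF DERIV_cdivide[OF this]]]
      have "(\<lambda>t. proot m a * exp (Ln (t / a) / of_nat m)) field_differentiable (at a)"
        unfolding field_differentiable_def by blast
      then have "(\<lambda>t. proot m (z0 $ i) * exp (Ln (t / z0 $ i) / of_nat m)) field_differentiable (at (z0 $ i))"
        by (simp add: a_def)
      from cdiff_at_compose_univariate[of _ "\<lambda>z. z $ i", OF this cdiff_at_nth]
      show ?thesis using True by (simp add: y_def)
    qed (simp add: cdiff_at_nth)
    then have "cdiff_at (\<lambda>z. W (upd i (y z) z)) z0"
      by (rule cdiff_at_compose[where G = "\<lambda>z. upd i (y z) z", OF r(2)[OF near[OF z0(1) y0]]])
    moreover have "\<forall>\<^sub>F z in nhds z0. W (upd i (y z) z) = w z"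
    proof -
      have "((\<lambda>z. z $ i) \<longlongrightarrow> z0 $ i) (nhds z0)"
        by (intro tendsto_vec_nth filterlim_ident)
      then have "\<forall>\<^sub>F z in nhds z0. z $ i \<noteq> 0"
        using z0(2) by (rule tendsto_imp_eventually_ne)
      then show ?thesis
      proof eventually_elim
        case (elim z)
        have "y z ^ m = z0 $ i * exp (of_nat m * (Ln (z $ i / z0 $ i) / of_nat m))"
          by (simp add: y_def power_mult_distrib proot_power \<open>m > 0\<close> flip: exp_of_nat_mult)
        also have "\<dots> = z $ i" using elim z0(2) \<open>m > 0\<close> by simp
        finally show ?case by (simp add: w)
      qed
    qed
    ultimately show ?thesis by (rule cdiff_at_transform)
  qed
  have wcont: "continuous_on (ball 0 d) w"
  proof (rule continuous_at_imp_continuous_on, rule ballI)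
    fix z0 :: "complex ^ 'n" assume z0: "z0 \<in> ball 0 d"
    show "isCont w z0"
    proof (cases "z0 $ i = 0")
      case False
      then show ?thesis using wdiff[OF z0] cdiff_at_imp_continuous by blast
    next
      case True
      define G where "G = (\<lambda>z. upd i (proot m (z $ i)) z)"
      have G0: "G z0 = z0" using True by (simp add: G_def proot_def vec_eq_iff)
      have "isCont G z0"
        unfolding isCont_def
      proof (rule vec_tendstoI)
        fix j
        show "(\<lambda>z. G z $ j) \<midarrow>z0\<rightarrow> G z0 $ j"
        proof (cases "j = i")
          case True
          have "(\<lambda>z. root m (norm (z $ i))) \<midarrow>z0\<rightarrow> root m (norm (z0 $ i))"
            by (intro tendsto_intros)
          then have "(\<lambda>z. proot m (z $ i)) \<midarrow>z0\<rightarrow> 0"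
            using \<open>z0 $ i = 0\<close> \<open>m > 0\<close> by - (rule tendsto_norm_zero_cancel, simp add: norm_proot)
          then show ?thesis using True \<open>z0 $ i = 0\<close> by (simp add: G_def proot_def)
        next
          case False
          then show ?thesis by (auto simp: G_def intro: tendsto_intros)
        qed
      qed
      moreover have "isCont W (G z0)"
        using r(2)[OF near[OF z0, of "z0 $ i"]] True \<open>m > 0\<close> G0 upd_same[of i z0, unfolded True]
        by (simp add: cdiff_at_imp_continuous power_0_left)
      ultimately have "isCont (\<lambda>z. W (G z)) z0" by (rule isCont_o2)
      then show ?thesis by (simp add: w_def G_def)
    qed
  qed
  have "cdiff_at w z" if "z \<in> ball 0 d" for z
    using cdiff_removable_singularity[OF open_ball wcont wdiff that] .
  then have "holo w"
    unfolding holo_def eventually_nhds_metric using d by (auto simp: dist_commute)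
  moreover have "W z = w (upd i ((z $ i) ^ m) z)" for z
    by (subst w[of "z $ i"]) simp_all
  ultimately show ?thesis using that by simp
qed

text \<open>The polynomial \<open>\<Prod>\<zeta>\<noteq>1. Z (c \<zeta>) - p \<zeta> (\<zeta> * t)\<close> vanishes at \<open>Z = F z\<close>, \<open>t = \<eta> * z $ y\<close> for each
  \<open>m\<close>-th root of unity \<open>\<eta> \<noteq> 1\<close>. Weighting \<open>h\<close> at the \<open>m\<close> conjugates of \<open>z\<close> by it gives an invariant
  function, which descends, and at \<open>Z = F z\<close> only the conjugate \<open>\<eta> = 1\<close> survives.\<close>

lemma conductor:
  fixes F :: "complex ^ 'n \<Rightarrow> complex ^ 'p" and T :: "complex ^ 'p \<Rightarrow> complex ^ 'n"
    and y :: 'n and c :: "complex \<Rightarrow> 'p" and p :: "complex \<Rightarrow> complex \<Rightarrow> complex"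
  assumes "m > 0" "holo h"
    and F: "\<And>j. holo (\<lambda>z. F z $ j)" "F 0 = 0"
    and T: "\<And>j. holo (\<lambda>z. T z $ j)" "\<And>z. T (F z) = upd y ((z $ y) ^ m) z"
    and p: "\<And>\<zeta>. \<forall>\<^sub>F t in nhds 0. p \<zeta> field_differentiable (at t)"
    and Fc: "\<And>\<zeta> z. F z $ c \<zeta> = p \<zeta> (z $ y)"
  shows "\<exists>w. holo w \<and> (\<forall>\<^sub>F z in nhds 0.
    h z * (\<Prod>\<zeta>\<in>{\<zeta>. \<zeta> ^ m = 1} - {1}. p \<zeta> (z $ y) - p \<zeta> (\<zeta> * z $ y)) = w (F z))"
proof -
  define \<mu> where "\<mu> = {\<zeta> :: complex. \<zeta> ^ m = 1}"
  have fin: "finite \<mu>"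
    unfolding \<mu>_def using \<open>m > 0\<close> by (intro finite_roots_unity) simp
  have T0: "T 0 = 0" using T(2)[of 0] F(2) \<open>m > 0\<close> by (simp add: vec_eq_iff power_0_left)
  \<comment> \<open>The values of \<open>F\<close> enter as independent variables. Substituting
    \<open>p \<zeta> (q $ Inr y)\<close> for them would in general destroy the invariance under
    rotations of the source coordinate.\<close>
  define W :: "complex ^ ('p + 'n) \<Rightarrow> complex" where
    "W = (\<lambda>q. \<Sum>\<eta>\<in>\<mu>. h (\<chi> j. if j = y then \<eta> * q $ Inr y else q $ Inr j) *
       (\<Prod>\<zeta>\<in>\<mu> - {1}. q $ Inl (c \<zeta>) - p \<zeta> (\<zeta> * \<eta> * q $ Inr y)))"
  have hW: "holo W"
    unfolding W_def
  proof (intro holo_sum holo_mult holo_prod holo_diff holo_nth)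
    fix \<eta> \<zeta>
    show "holo (\<lambda>q :: complex ^ ('p + 'n). h (\<chi> j. if j = y then \<eta> * q $ Inr y else q $ Inr j))"
    proof (rule holo_compose[OF \<open>holo h\<close>])
      show "holo (\<lambda>q :: complex ^ ('p + 'n). (\<chi> j. if j = y then \<eta> * q $ Inr y else q $ Inr j) $ j)" for j
        by (cases "j = y") auto
    qed (simp add: vec_eq_iff)
    show "holo (\<lambda>q :: complex ^ ('p + 'n). p \<zeta> (\<zeta> * \<eta> * q $ Inr y))"
      by (rule holo_compose_univariate[where p = "p \<zeta>"]) (auto intro: p)
  qed
  have inv: "W (upd (Inr y) (\<omega> * q $ Inr y) q) = W q" if "\<omega> ^ m = 1" for \<omega> q
  proof -
    have "\<omega> \<noteq> 0" using that \<open>m > 0\<close> by (auto simp: power_0_left)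
    \<comment> \<open>Multiplication by \<open>\<omega>\<close> permutes the roots of unity and
      hence the summands.\<close>
    show ?thesis
      unfolding W_def
      by (rule sum.reindex_bij_witness[where i = "\<lambda>\<eta>. \<eta> / \<omega>" and j = "\<lambda>\<eta>. \<eta> * \<omega>"])
        (use \<open>\<omega> \<noteq> 0\<close> that in \<open>auto simp: \<mu>_def power_mult_distrib power_divide mult.assoc cong: if_cong\<close>)
  qed
  obtain w where w: "holo w"
    "\<forall>\<^sub>F q in nhds 0. W q = w (upd (Inr y) ((q $ Inr y) ^ m) q)"
    using descend_power[OF hW \<open>m > 0\<close> inv] by blast
  define G :: "complex ^ 'n \<Rightarrow> complex ^ ('p + 'n)" where
    "G = (\<lambda>z. \<chi> s. case s of Inl j \<Rightarrow> F z $ j | Inr j \<Rightarrow> z $ j)"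
  \<comment> \<open>After descent only \<open>z $ y ^ m\<close> and the other source coordinates
    remain, and \<open>T\<close> recovers these from the target.\<close>
  define K :: "complex ^ 'p \<Rightarrow> complex ^ ('p + 'n)" where
    "K = (\<lambda>Z. \<chi> s. case s of Inl j \<Rightarrow> Z $ j | Inr j \<Rightarrow> T Z $ j)"
  have "holo (\<lambda>Z. w (K Z))"
  proof (rule holo_compose[OF w(1)])
    show "holo (\<lambda>Z. K Z $ s)" for s
      by (cases s) (auto simp: K_def T)
  qed (auto simp: K_def T0 vec_eq_iff split: sum.split)
  moreover have "filterlim G (nhds 0) (nhds 0)"
  proof (rule filterlim_germ)
    show "holo (\<lambda>Z. G Z $ s)" for s
      by (cases s) (auto simp: G_def F)
  qed (auto simp: G_def F vec_eq_iff split: sum.split)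
  from eventually_compose_filterlim[OF w(2) this]
  have "\<forall>\<^sub>F z in nhds 0. h z * (\<Prod>\<zeta>\<in>\<mu> - {1}. p \<zeta> (z $ y) - p \<zeta> (\<zeta> * z $ y)) = w (K (F z))"
  proof eventually_elim
    case (elim z)
    have "W (G z) = (\<Sum>\<eta>\<in>\<mu>. if \<eta> = 1 then h z * (\<Prod>\<zeta>\<in>\<mu> - {1}. p \<zeta> (z $ y) - p \<zeta> (\<zeta> * z $ y)) else 0)"
      unfolding W_def
    proof (rule sum.cong[OF refl])
      fix \<eta> assume \<eta>: "\<eta> \<in> \<mu>"
      show "h (\<chi> j. if j = y then \<eta> * G z $ Inr y else G z $ Inr j) *
          (\<Prod>\<zeta>\<in>\<mu> - {1}. G z $ Inl (c \<zeta>) - p \<zeta> (\<zeta> * \<eta> * G z $ Inr y)) =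
        (if \<eta> = 1 then h z * (\<Prod>\<zeta>\<in>\<mu> - {1}. p \<zeta> (z $ y) - p \<zeta> (\<zeta> * z $ y)) else 0)"
      proof (cases "\<eta> = 1")
        case True
        have "(\<chi> j. if j = y then \<eta> * G z $ Inr y else G z $ Inr j) = z"
          using True by (simp add: G_def vec_eq_iff)
        then show ?thesis using True by (simp add: G_def Fc del: mult_cancel_left mult_cancel_right)
      next
        case False
        have "\<eta> \<noteq> 0" using \<eta> \<open>m > 0\<close> by (auto simp: \<mu>_def power_0_left)
        \<comment> \<open>The factor with index \<open>1 / \<eta>\<close> undoes the rotation by
          \<open>\<eta>\<close>, so it compares \<open>p\<close> with itself at
          \<open>z $ y\<close>.\<close>
        then have "1 / \<eta> \<in> \<mu> - {1}" using \<eta> False by (auto simp: \<mu>_def power_divide)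
        moreover have "G z $ Inl (c (1 / \<eta>)) - p (1 / \<eta>) (1 / \<eta> * \<eta> * G z $ Inr y) = 0"
          using \<open>\<eta> \<noteq> 0\<close> by (simp add: G_def Fc)
        ultimately have "(\<Prod>\<zeta>\<in>\<mu> - {1}. G z $ Inl (c \<zeta>) - p \<zeta> (\<zeta> * \<eta> * G z $ Inr y)) = 0"
          by (intro prod_zero finite_Diff fin bexI[where x = "1 / \<eta>"])
        then show ?thesis using False by simp
      qed
    qed
    also have "\<dots> = h z * (\<Prod>\<zeta>\<in>\<mu> - {1}. p \<zeta> (z $ y) - p \<zeta> (\<zeta> * z $ y))"
      using fin by (simp add: \<mu>_def)
    finally have "h z * (\<Prod>\<zeta>\<in>\<mu> - {1}. p \<zeta> (z $ y) - p \<zeta> (\<zeta> * z $ y)) = w (upd (Inr y) ((G z $ Inr y) ^ m) (G z))"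
      using elim by simp
    also have "upd (Inr y) ((G z $ Inr y) ^ m) (G z) = K (F z)"
      by (auto simp: vec_eq_iff G_def K_def T split: sum.split)
    finally show ?case .
  qed
  ultimately show ?thesis unfolding \<mu>_def by blast
qed

section \<open>Left equivalence\<close>

lemma holomorphic_germ_iff:
  fixes f :: "complex ^ 'n \<Rightarrow> complex ^ 'p"
  shows "holomorphic_germ f \<longleftrightarrow> f 0 = 0 \<and> (\<forall>c. holo (\<lambda>x. f x $ c))"
proof -
  have eq: "(\<exists>A :: complex ^ 'n ^ 'p. (f has_derivative (\<lambda>v. A *v v)) (at x)) \<longleftrightarrow> (\<forall>c. cdiff_at (\<lambda>x. f x $ c) x)" for x
  proof
    assume "\<exists>A :: complex ^ 'n ^ 'p. (f has_derivative (\<lambda>v. A *v v)) (at x)"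
    then obtain A :: "complex ^ 'n ^ 'p" where A: "(f has_derivative (\<lambda>v. A *v v)) (at x)" by blast
    show "\<forall>c. cdiff_at (\<lambda>x. f x $ c) x"
    proof
      fix c
      show "cdiff_at (\<lambda>x. f x $ c) x"
        by (rule cdiff_atI[OF bounded_linear.has_derivative[OF bounded_linear_vec_nth A]])
          (simp add: matrix_vector_mult_def sum_distrib_left mult_ac)
    qed
  next
    assume c: "\<forall>c. cdiff_at (\<lambda>x. f x $ c) x"
    define A :: "complex ^ 'n ^ 'p" where "A = (\<chi> c i. cpartial i (\<lambda>x. f x $ c) x)"
    have "(f has_derivative (\<lambda>v. A *v v)) (at x)"
    proof (rule has_derivative_vecI)
      fix j
      show "((\<lambda>z. f z $ j) has_derivative (\<lambda>v. (A *v v) $ j)) (at x)"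
        using cdiff_at_cpartial[OF c[rule_format, of j]] by (simp add: A_def matrix_vector_mult_def)
    qed
    then show "\<exists>A :: complex ^ 'n ^ 'p. (f has_derivative (\<lambda>v. A *v v)) (at x)" by blast
  qed
  show ?thesis
    unfolding holomorphic_germ_def eq holo_def
    using eventually_ball_finite_distrib[of UNIV "\<lambda>x c. cdiff_at (\<lambda>x. f x $ c) x" "nhds 0"] by simp
qed

text \<open>The real inverse function theorem supplies a differentiable local inverse; it is
  holomorphic because the inverse of a complex linear bijection is complex linear.\<close>

lemma inverse_germ_exists:
  fixes \<psi> :: "complex ^ 'p \<Rightarrow> complex ^ 'p"
  assumes \<psi>: "holomorphic_germ \<psi>" and der: "(\<psi> has_derivative (\<lambda>v. v)) (at 0)"
  shows "\<exists>\<psi>'. inverse_germs \<psi> \<psi>'"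
proof -
  have holo: "\<And>c. holo (\<lambda>x. \<psi> x $ c)" and "\<psi> 0 = 0"
    using \<psi> by (simp_all add: holomorphic_germ_iff)
  \<comment> \<open>The partial derivatives are again holomorphic, hence continuous near
    \<open>0\<close>; this is the continuous differentiability that the theorem asks for.\<close>
  define D where "D = (\<lambda>c i. cpartial i (\<lambda>x. \<psi> x $ c))"
  have "\<forall>\<^sub>F x in nhds 0. (\<forall>c. cdiff_at (\<lambda>x. \<psi> x $ c) x) \<and> (\<forall>c i. cdiff_at (D c i) x)"
    using holo holo_cpartial[OF holo] unfolding holo_def D_def
    by (intro eventually_conj eventually_all_finite)
  then obtain r where r: "r > 0" "\<And>x c. x \<in> ball 0 r \<Longrightarrow> cdiff_at (\<lambda>x. \<psi> x $ c) x"
    "\<And>x c i. x \<in> ball 0 r \<Longrightarrow> cdiff_at (D c i) x"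
    unfolding eventually_nhds_metric by (auto simp: dist_commute)
  define L where "L = (\<lambda>x v. \<chi> c. \<Sum>i\<in>UNIV. D c i x * v $ i)"
  have L: "(\<psi> has_derivative L x) (at x)" if "x \<in> ball 0 r" for x
    by (rule has_derivative_vecI) (use cdiff_at_cpartial[OF r(2)[OF that]] in \<open>simp add: L_def D_def\<close>)
  have scale: "L x (a *s v) = a *s L x v" for x a v
    by (simp add: L_def vec_eq_iff sum_distrib_left mult_ac)
  define f' where "f' = (\<lambda>x. Blinfun (L x))"
  have f': "blinfun_apply (f' x) = L x" if "x \<in> ball 0 r" for x
    unfolding f'_def by (rule bounded_linear_Blinfun_apply[OF has_derivative_bounded_linear[OF L[OF that]]])
  have cont: "continuous_on (ball 0 r) f'"
  proof (rule continuous_on_blinfun_componentwise)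
    fix v
    have "continuous_on (ball 0 r) (\<lambda>x. L x v)"
      unfolding L_def
      by (intro continuous_on_vec_lambda continuous_on_sum continuous_on_mult continuous_on_const
          cdiff_on_imp_continuous_on r(3))
    then show "continuous_on (ball 0 r) (\<lambda>x. blinfun_apply (f' x) v)"
      by (rule continuous_on_eq) (simp add: f')
  qed
  have derf: "(\<psi> has_derivative blinfun_apply (f' x)) (at x)" if "x \<in> ball 0 r" for x
    using L f' that by simp
  have invf: "id_blinfun o\<^sub>L f' 0 = id_blinfun"
  proof -
    have "L 0 = (\<lambda>v. v)" by (rule has_derivative_unique[OF L der]) (use r(1) in simp)
    then show ?thesis using f'[of 0] r(1) by (intro blinfun_eqI) simp
  qed
  have zero: "0 \<in> ball (0 :: complex ^ 'p) r" using r(1) by simp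
  obtain U V g g' where g: "open U" "U \<subseteq> ball 0 r" "0 \<in> U" "open V" "\<psi> 0 \<in> V"
    "homeomorphism U V \<psi> g" "\<And>y. y \<in> V \<Longrightarrow> (g has_derivative (g' y)) (at y)"
    "\<And>y. y \<in> V \<Longrightarrow> g' y = inv (blinfun_apply (f' (g y)))"
    "\<And>y. y \<in> V \<Longrightarrow> bij (blinfun_apply (f' (g y)))"
    by (rule inverse_function_theorem[OF open_ball derf cont zero invf]) (assumption, rule that)
  have gU: "g y \<in> U" if "y \<in> V" for y
    using g(6) that by (auto simp: homeomorphism_def)
  have "g 0 = 0" using g(3,6) \<open>\<psi> 0 = 0\<close> by (metis homeomorphism_apply1)
  have evV: "\<forall>\<^sub>F y in nhds 0. y \<in> V" and evU: "\<forall>\<^sub>F x in nhds 0. x \<in> U"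
    using g(1,3,4,5) \<open>\<psi> 0 = 0\<close> by (auto intro: eventually_nhds_in_open)
  have "cdiff_at (\<lambda>y. g y $ c) y" if "y \<in> V" for c y
  proof (rule cdiff_atI[OF bounded_linear.has_derivative[OF bounded_linear_vec_nth g(7)[OF that]]])
    fix a v
    have eq: "g' y = inv (L (g y))" and bij: "bij (L (g y))"
      using g(8,9)[OF that] f' gU[OF that] g(2) by auto
    have "L (g y) (a *s inv (L (g y)) v) = a *s v"
      using bij by (simp add: scale bij_is_surj surj_f_inv_f)
    then have "inv (L (g y)) (a *s v) = a *s inv (L (g y)) v"
      using bij by (metis bij_inv_eq_iff)
    then show "g' y (a *s v) $ c = a * g' y v $ c" by (simp add: eq)
  qed
  then have "holomorphic_germ g"
    unfolding holomorphic_germ_iff holo_def using evV \<open>g 0 = 0\<close> by (auto elim: eventually_mono)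
  moreover have "\<forall>\<^sub>F x in nhds 0. g (\<psi> x) = x"
    using evU by (rule eventually_mono) (use g(6) in \<open>simp add: homeomorphism_apply1\<close>)
  moreover have "\<forall>\<^sub>F y in nhds 0. \<psi> (g y) = y"
    using evV by (rule eventually_mono) (use g(6) in \<open>simp add: homeomorphism_apply2\<close>)
  ultimately show ?thesis using \<psi> unfolding inverse_germs_def by blast
qed

section \<open>Functions pulled back from the target\<close>

text \<open>Flat means to first order only: this suffices for the identity plus such germs to have
  the identity as derivative at \<open>0\<close>.\<close>

definition flat_pullback :: "(complex ^ 'n \<Rightarrow> complex ^ 'p) \<Rightarrow> (complex ^ 'n \<Rightarrow> complex) \<Rightarrow> bool" where
  "flat_pullback f h \<longleftrightarrow> (\<exists>H. holo H \<and> H 0 = 0 \<and> (H has_derivative (\<lambda>_. 0)) (at 0) \<and>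
     (\<forall>\<^sub>F z in nhds 0. h z = H (f z)))"

text \<open>The components of \<open>g - f\<close> are pulled back one by one and assembled into a
  change of target coordinates, while the source coordinates stay fixed.\<close>

lemma A_finite_if_flat_pullback:
  fixes f :: "complex ^ 'n \<Rightarrow> complex ^ 'p"
  assumes f: "holomorphic_germ f"
    and pull: "\<And>h. holo h \<Longrightarrow> vanishes s h \<Longrightarrow> flat_pullback f h"
  shows "A_finite f"
  unfolding A_finite_def
proof (intro conjI f exI[of _ s] allI impI)
  fix g assume g: "holomorphic_germ g \<and> same_jet s f g"
  have "flat_pullback f (\<lambda>z. g z $ c - f z $ c)" for c
  proof (rule pull)
    have fg: "holo (\<lambda>z. f z $ c)" "holo (\<lambda>z. g z $ c)"
      using f g by (simp_all add: holomorphic_germ_iff)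
    from fg(2,1) show "holo (\<lambda>z. g z $ c - f z $ c)" by (rule holo_diff)
    \<comment> \<open>Agreement of jets through order \<open>s\<close> even gives order
      \<open>Suc s\<close>.\<close>
    show "vanishes s (\<lambda>z. g z $ c - f z $ c)"
      by (rule vanishes_mono[OF same_jet_vanishes[OF fg]]) (use g in auto)
  qed
  then have "\<exists>H. \<forall>c. holo (H c) \<and> H c 0 = 0 \<and> (H c has_derivative (\<lambda>_. 0)) (at 0) \<and>
      (\<forall>\<^sub>F z in nhds 0. g z $ c - f z $ c = H c (f z))"
    unfolding flat_pullback_def by (intro choice) blast
  then obtain H where H: "\<And>c. holo (H c)" "\<And>c. H c 0 = 0"
    "\<And>c. (H c has_derivative (\<lambda>_. 0)) (at 0)"
    "\<And>c. \<forall>\<^sub>F z in nhds 0. g z $ c - f z $ c = H c (f z)"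
    by blast
  define \<psi> :: "complex ^ 'p \<Rightarrow> complex ^ 'p" where "\<psi> = (\<lambda>Z. \<chi> c. Z $ c + H c Z)"
  have "holomorphic_germ \<psi>"
    unfolding holomorphic_germ_iff using H by (auto simp: \<psi>_def vec_eq_iff)
  moreover have "(\<psi> has_derivative (\<lambda>v. v)) (at 0)"
  proof (rule has_derivative_vecI)
    fix c
    have "((\<lambda>Z. Z $ c + H c Z) has_derivative (\<lambda>v. v $ c + 0)) (at 0)"
      by (intro has_derivative_add H bounded_linear_imp_has_derivative bounded_linear_vec_nth)
    then show "((\<lambda>Z. \<psi> Z $ c) has_derivative (\<lambda>v. v $ c)) (at 0)" by (simp add: \<psi>_def)
  qed
  ultimately obtain \<psi>' where "inverse_germs \<psi> \<psi>'" using inverse_germ_exists by blast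
  moreover have "inverse_germs (\<lambda>x. x) (\<lambda>x :: complex ^ 'n. x)"
    by (simp add: inverse_germs_def holomorphic_germ_iff)
  moreover have "\<forall>\<^sub>F z in nhds 0. g z = \<psi> (f z)"
    using eventually_all_finite[OF H(4)]
    by (rule eventually_mono) (auto simp: \<psi>_def vec_eq_iff algebra_simps)
  ultimately show "A_equivalent f g" unfolding A_equivalent_def by blast
qed

text \<open>By the product rule, a product of two germs with a common zero has derivative zero
  there. All flatness below comes from this.\<close>

lemma flat_pullback_mult:
  assumes "holo A" "holo B" "A 0 = 0" "B 0 = 0" "\<forall>\<^sub>F z in nhds 0. h z = A (f z) * B (f z)"
  shows "flat_pullback f h"
  unfolding flat_pullback_def
proof (intro exI conjI)
  obtain L M where "(A has_derivative L) (at 0)" "(B has_derivative M) (at 0)"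
    using assms(1,2)[THEN holo_imp_cdiff] unfolding cdiff_at_def by blast
  from has_derivative_mult[OF this]
  show "((\<lambda>Z. A Z * B Z) has_derivative (\<lambda>_. 0)) (at 0)" using assms by simp
  show "\<forall>\<^sub>F z in nhds 0. h z = A (f z) * B (f z)" by fact
qed (use assms in auto)

lemma flat_pullback_add:
  assumes "flat_pullback f g" "flat_pullback f h"
  shows "flat_pullback f (\<lambda>z. g z + h z)"
proof -
  obtain A B where A: "holo A" "A 0 = 0" "(A has_derivative (\<lambda>_. 0)) (at 0)" "\<forall>\<^sub>F z in nhds 0. g z = A (f z)"
    and B: "holo B" "B 0 = 0" "(B has_derivative (\<lambda>_. 0)) (at 0)" "\<forall>\<^sub>F z in nhds 0. h z = B (f z)"
    using assms unfolding flat_pullback_def by blast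
  show ?thesis
    unfolding flat_pullback_def
  proof (intro exI[of _ "\<lambda>Z. A Z + B Z"] conjI)
    show "((\<lambda>Z. A Z + B Z) has_derivative (\<lambda>_. 0)) (at 0)"
      using has_derivative_add[OF A(3) B(3)] by simp
    show "\<forall>\<^sub>F z in nhds 0. g z + h z = A (f z) + B (f z)"
      using A(4) B(4) by eventually_elim simp
  qed (use A B in auto)
qed

lemma flat_pullback_zero: "flat_pullback f (\<lambda>_. 0)"
  by (rule flat_pullback_mult[of "\<lambda>_. 0" "\<lambda>_. 0"]) auto

lemma flat_pullback_sum:
  "(\<And>i. i \<in> I \<Longrightarrow> flat_pullback f (h i)) \<Longrightarrow> flat_pullback f (\<lambda>z. \<Sum>i\<in>I. h i z)"
  by (induction I rule: infinite_finite_induct) (auto intro: flat_pullback_zero flat_pullback_add)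

lemma flat_pullback_cong:
  assumes "flat_pullback f g" "\<forall>\<^sub>F z in nhds 0. h z = g z"
  shows "flat_pullback f h"
proof -
  obtain H where "holo H" "H 0 = 0" "(H has_derivative (\<lambda>_. 0)) (at 0)" and H: "\<forall>\<^sub>F z in nhds 0. g z = H (f z)"
    using assms(1) unfolding flat_pullback_def by blast
  moreover have "\<forall>\<^sub>F z in nhds 0. h z = H (f z)" using H assms(2) by eventually_elim simp
  ultimately show ?thesis unfolding flat_pullback_def by blast
qed

section \<open>The conductor of a primitive curve\<close>

text \<open>The exponents \<open>i\<close> with \<open>\<zeta> ^ i = 1\<close> are multiples of the
  order \<open>d > 1\<close> of \<open>\<zeta>\<close>. If every occurring exponent were among them,
  \<open>d\<close> would divide their greatest common divisor.\<close>

lemma primitive_separates_roots: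
  fixes \<zeta> :: complex
  assumes "primitive \<phi>" "m > 0" "\<zeta> ^ m = 1" "\<zeta> \<noteq> 1"
  shows "\<exists>j i. fps_nth (\<phi> j) i \<noteq> 0 \<and> \<zeta> ^ i \<noteq> 1"
proof (rule ccontr)
  assume "\<nexists>j i. fps_nth (\<phi> j) i \<noteq> 0 \<and> \<zeta> ^ i \<noteq> 1"
  then have trivial: "\<zeta> ^ i = 1" if "fps_nth (\<phi> j) i \<noteq> 0" for i j
    using that by blast
  define d where "d = (LEAST d. d > 0 \<and> \<zeta> ^ d = 1)"
  have d: "d > 0 \<and> \<zeta> ^ d = 1"
    unfolding d_def by (rule LeastI[of _ m]) (use assms in simp)
  have "d dvd i" if "\<zeta> ^ i = 1" for i
  proof -
    have "\<zeta> ^ i = (\<zeta> ^ d) ^ (i div d) * \<zeta> ^ (i mod d)"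
      by (simp flip: power_mult power_add)
    then have "\<zeta> ^ (i mod d) = 1" using d that by simp
    moreover have "i mod d < d" using d by simp
    ultimately have "i mod d = 0"
      using not_less_Least[of "i mod d" "\<lambda>d. d > 0 \<and> \<zeta> ^ d = 1", folded d_def] by auto
    then show ?thesis by auto
  qed
  then have "d dvd Gcd {i. \<exists>j. fps_nth (\<phi> j) i \<noteq> 0}"
    using trivial by (intro Gcd_greatest) blast
  then have "d = 1" using assms(1) by (simp add: primitive_def)
  then show False using d assms(4) by simp
qed

lemma eval_fps_field_differentiable:
  fixes \<phi> :: "complex fps"
  assumes "fps_conv_radius \<phi> > 0"
  shows "\<forall>\<^sub>F t in nhds 0. eval_fps \<phi> field_differentiable (at t)"
proof -
  have "\<forall>\<^sub>F t in nhds 0. t \<in> eball 0 (fps_conv_radius \<phi>)"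
    using assms by (intro eventually_nhds_in_open) (auto simp: zero_ereal_def)
  then show ?thesis
    by (rule eventually_mono)
      (auto simp: field_differentiable_def intro: has_field_derivative_eval_fps)
qed

text \<open>The difference has coefficients \<open>(1 - \<zeta> ^ n) * fps_nth \<phi> n\<close>, not
  all zero. Splitting off its lowest power leaves a unit, so the product in \<open>conductor\<close>
  becomes a power of \<open>y\<close> times a unit.\<close>

lemma eval_fps_twist_factor:
  fixes \<phi> :: "complex fps"
  assumes R: "fps_conv_radius \<phi> > 0" and "norm \<zeta> = 1" "fps_nth \<phi> i \<noteq> 0" "\<zeta> ^ i \<noteq> 1"
  shows "\<exists>e v. v 0 \<noteq> 0 \<and> (\<forall>\<^sub>F t in nhds 0. v field_differentiable (at t)) \<and>
    (\<forall>\<^sub>F t in nhds 0. eval_fps \<phi> t - eval_fps \<phi> (\<zeta> * t) = t ^ e * v t)"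
proof -
  define \<theta> where "\<theta> = Abs_fps (\<lambda>n. \<zeta> ^ n * fps_nth \<phi> n)"
  \<comment> \<open>The radius of convergence depends only on the moduli of the coefficients, which
    the twist preserves.\<close>
  have "fps_conv_radius \<theta> = fps_conv_radius (Abs_fps (\<lambda>n. norm (fps_nth \<theta> n)))" by simp
  also have "(\<lambda>n. norm (fps_nth \<theta> n)) = (\<lambda>n. norm (fps_nth \<phi> n))"
    using assms(2) by (simp add: \<theta>_def norm_mult norm_power)
  finally have R\<theta>: "fps_conv_radius \<theta> = fps_conv_radius \<phi>" by simp
  have \<theta>: "eval_fps \<theta> t = eval_fps \<phi> (\<zeta> * t)" for t
    by (simp add: eval_fps_def \<theta>_def power_mult_distrib mult_ac)
  define \<delta> where "\<delta> = \<phi> - \<theta>"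
  have "fps_nth \<delta> i = fps_nth \<phi> i * (1 - \<zeta> ^ i)" by (simp add: \<delta>_def \<theta>_def algebra_simps)
  then have "\<delta> \<noteq> 0" using assms(3,4) by auto
  have R\<delta>: "fps_conv_radius \<delta> \<ge> fps_conv_radius \<phi>"
    using fps_conv_radius_diff[of \<phi> \<theta>] by (simp add: \<delta>_def R\<theta>)
  define e where "e = subdegree \<delta>"
  define v where "v = eval_fps (fps_shift e \<delta>)"
  have "v 0 \<noteq> 0"
    using \<open>\<delta> \<noteq> 0\<close> by (simp add: v_def eval_fps_at_0 e_def)
  moreover have "\<forall>\<^sub>F t in nhds 0. v field_differentiable (at t)"
    unfolding v_def using less_le_trans[OF R R\<delta>] by (intro eval_fps_field_differentiable) simp
  moreover have "\<forall>\<^sub>F t in nhds 0. eval_fps \<phi> t - eval_fps \<phi> (\<zeta> * t) = t ^ e * v t"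
  proof -
    have "\<forall>\<^sub>F t in nhds 0. t \<in> eball 0 (fps_conv_radius \<phi>)"
      using R by (intro eventually_nhds_in_open) (auto simp: zero_ereal_def)
    then show ?thesis
    proof eventually_elim
      case (elim t)
      then have t: "norm t < fps_conv_radius \<phi>" by simp
      have "eval_fps \<phi> t - eval_fps \<phi> (\<zeta> * t) = eval_fps \<delta> t"
        using t R\<theta> by (simp add: \<delta>_def eval_fps_diff \<theta>)
      also have "\<dots> = t ^ e * v t"
        using eval_fps_shift[of e \<delta> t] less_le_trans[OF t R\<delta>]
        by (cases "t = 0") (auto simp: v_def e_def eval_fps_at_0 power_0_left)
      finally show ?case .
    qed
  qed
  ultimately show ?thesis by blast
qed

section \<open>The map-germ\<close>

locale primitive_join =
  fixes m :: "'k :: {finite, linorder} \<Rightarrow> nat"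
    and a :: "'k \<Rightarrow> nat \<Rightarrow> complex"
    and lam :: "'a :: finite \<Rightarrow> nat"
    and f :: "complex ^ ('a + 1) \<Rightarrow> complex ^ ('a + 'k + 'a)"
  assumes m: "1 < m (Min UNIV)" "mono m"
    and radius: "\<forall>j. fps_conv_radius (curve_series m a j) > 0"
    and prim: "primitive (curve_series m a)"
    and lam: "\<forall>i. lam i \<ge> 1"
    and f_def: "f = join id (curve (curve_series m a)) (xpow_times_y lam)"
begin

lemma f_nth [simp]:
  "f z $ Inl i = z $ Inl i"
  "f z $ Inr (Inl j) = eval_fps (curve_series m a j) (z $ Inr 1)"
  "f z $ Inr (Inr i) = (z $ Inl i) ^ lam i * z $ Inr 1"
  unfolding f_def by (rule join_components)+

lemma m_gt_1: "m j > 1"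
  using m monoD[OF m(2), of "Min UNIV" j] by simp

lemma curve_series_nth_low: "n \<le> 1 \<Longrightarrow> fps_nth (curve_series m a j) n = 0"
  using m_gt_1[of j] by (auto simp: curve_series_def fps_X_power_iff)

lemma curve_series_Min: "curve_series m a (Min UNIV) = fps_X ^ m (Min UNIV)"
  by (simp add: curve_series_def)

lemma f_zero: "f 0 = 0"
proof -
  have "f 0 $ s = 0" for s
  proof (cases s)
    case (Inr t)
    then show ?thesis by (cases t) (auto simp: eval_fps_at_0 curve_series_nth_low)
  qed simp
  then show ?thesis by (simp add: vec_eq_iff)
qed

lemma holo_f: "holo (\<lambda>z. f z $ s)"
proof (cases s)
  case (Inr t)
  then show ?thesis
  proof (cases t)
    case (Inl j)
    have "holo (\<lambda>z :: complex ^ ('a + 1). eval_fps (curve_series m a j) (z $ Inr 1))"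
      by (rule holo_compose_univariate) (simp_all add: eval_fps_field_differentiable radius)
    then show ?thesis using Inr Inl by simp
  next
    case Inr': (Inr i)
    then show ?thesis using Inr by (auto intro!: holo_mult holo_power)
  qed
qed simp

lemma holomorphic_germ_f: "holomorphic_germ f"
  by (simp add: holomorphic_germ_iff f_zero holo_f)

text \<open>Each root of unity other than \<open>1\<close> is given a component of the curve that
  separates it. The product of the resulting differences is a unit times a power of \<open>y\<close>
  that is independent of \<open>k\<close>.\<close>

lemma flat_pullback_conductor:
  "\<exists>c. \<forall>k. holo k \<longrightarrow> flat_pullback f (\<lambda>z. (z $ Inr 1) ^ c * k z)"
proof -
  define M where "M = m (Min UNIV)"
  have "M > 0" using m_gt_1[of "Min UNIV"] by (simp add: M_def)
  define \<mu> where "\<mu> = {\<zeta> :: complex. \<zeta> ^ M = 1} - {1}"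
  define P where "P = (\<lambda>\<zeta> j e v. v 0 \<noteq> 0 \<and> (\<forall>\<^sub>F t in nhds 0. v field_differentiable (at t)) \<and>
      (\<forall>\<^sub>F t in nhds 0. eval_fps (curve_series m a j) t - eval_fps (curve_series m a j) (\<zeta> * t) = t ^ e * v t))"
  have "\<exists>j e v. P \<zeta> j e v" if "\<zeta> \<in> \<mu>" for \<zeta>
  proof -
    have \<zeta>: "\<zeta> ^ M = 1" "\<zeta> \<noteq> 1" using that by (auto simp: \<mu>_def)
    obtain j i where "fps_nth (curve_series m a j) i \<noteq> 0" "\<zeta> ^ i \<noteq> 1"
      using primitive_separates_roots[OF prim \<open>M > 0\<close> \<zeta>] by blast
    moreover have "norm \<zeta> = 1"
      using \<zeta>(1) \<open>M > 0\<close> power_eq_1_iff by blast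
    ultimately show ?thesis
      unfolding P_def by (intro exI[of _ j] eval_fps_twist_factor radius[rule_format])
  qed
  then obtain j e v where "\<And>\<zeta>. \<zeta> \<in> \<mu> \<Longrightarrow> P \<zeta> (j \<zeta>) (e \<zeta>) (v \<zeta>)"
    by metis
  then have v: "\<And>\<zeta>. \<zeta> \<in> \<mu> \<Longrightarrow> v \<zeta> 0 \<noteq> 0"
    "\<And>\<zeta>. \<zeta> \<in> \<mu> \<Longrightarrow> \<forall>\<^sub>F t in nhds 0. v \<zeta> field_differentiable (at t)"
    "\<And>\<zeta>. \<zeta> \<in> \<mu> \<Longrightarrow> \<forall>\<^sub>F t in nhds 0. eval_fps (curve_series m a (j \<zeta>)) t -
      eval_fps (curve_series m a (j \<zeta>)) (\<zeta> * t) = t ^ e \<zeta> * v \<zeta> t"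
    by (auto simp: P_def)
  have fin: "finite \<mu>"
    unfolding \<mu>_def using \<open>M > 0\<close> by (intro finite_Diff finite_roots_unity) simp
  \<comment> \<open>The first component of the curve is exactly \<open>y ^ M\<close>, so
    \<open>T\<close> recovers \<open>x\<close> and \<open>y ^ M\<close> without error terms.\<close>
  define T :: "complex ^ ('a + 'k + 'a) \<Rightarrow> complex ^ ('a + 1)" where
    "T = (\<lambda>Z. \<chi> s. case s of Inl i \<Rightarrow> Z $ Inl i | Inr _ \<Rightarrow> Z $ Inr (Inl (Min UNIV)))"
  \<comment> \<open>\<open>sum e \<mu>\<close> comes from the differences of conjugates;
    \<open>2 * M\<close> supplies two copies of the first component, one for each factor of a flat
    product.\<close>
  have "flat_pullback f (\<lambda>z. (z $ Inr 1) ^ (sum e \<mu> + 2 * M) * k z)" if "holo k" for k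
  proof -
    \<comment> \<open>The units are divided out in advance, so that the product of differences turns
      \<open>h\<close> into \<open>k\<close> times an exact power of \<open>y\<close>.\<close>
    define h where "h = (\<lambda>z :: complex ^ ('a + 1). k z * (\<Prod>\<zeta>\<in>\<mu>. inverse (v \<zeta> (z $ Inr 1))))"
    have ne: "\<forall>\<^sub>F t in nhds 0. v \<zeta> t \<noteq> 0" if "\<zeta> \<in> \<mu>" for \<zeta>
    proof -
      have "isCont (v \<zeta>) 0"
        using eventually_nhds_x_imp_x[OF v(2)[OF that]] by (rule field_differentiable_imp_continuous_at)
      then have "(v \<zeta> \<longlongrightarrow> v \<zeta> 0) (nhds 0)"
        by (simp add: isCont_def tendsto_at_iff_tendsto_nhds)
      then show ?thesis using v(1)[OF that] by (rule tendsto_imp_eventually_ne)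
    qed
    have "holo h"
      unfolding h_def
    proof (intro holo_mult that holo_prod)
      fix \<zeta> assume \<zeta>: "\<zeta> \<in> \<mu>"
      have "\<forall>\<^sub>F t in nhds 0. (\<lambda>t. inverse (v \<zeta> t)) field_differentiable (at t)"
        using v(2)[OF \<zeta>] ne[OF \<zeta>] by eventually_elim (rule field_differentiable_inverse)
      then show "holo (\<lambda>z :: complex ^ ('a + 1). inverse (v \<zeta> (z $ Inr 1)))"
        by (intro holo_compose_univariate[where p = "\<lambda>t. inverse (v \<zeta> t)"]) auto
    qed
    have Th: "holo (\<lambda>Z. T Z $ s)" for s by (cases s) (auto simp: T_def)
    have Tf: "T (f z) = upd (Inr 1) ((z $ Inr 1) ^ M) z" for z
      by (auto simp: T_def vec_eq_iff curve_series_Min M_def split: sum.split)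
    obtain w where w: "holo w"
      "\<forall>\<^sub>F z in nhds 0. h z * (\<Prod>\<zeta>\<in>\<mu>. eval_fps (curve_series m a (j \<zeta>)) (z $ Inr 1) -
         eval_fps (curve_series m a (j \<zeta>)) (\<zeta> * z $ Inr 1)) = w (f z)"
      using conductor[OF \<open>M > 0\<close> \<open>holo h\<close> holo_f f_zero Th Tf,
          where c = "\<lambda>\<zeta>. Inr (Inl (j \<zeta>))" and p = "\<lambda>\<zeta>. eval_fps (curve_series m a (j \<zeta>))"]
      unfolding \<mu>_def by (auto simp: eval_fps_field_differentiable radius)
    have "\<forall>\<^sub>F t in nhds 0. \<forall>\<zeta>\<in>\<mu>. v \<zeta> t \<noteq> 0 \<and> eval_fps (curve_series m a (j \<zeta>)) t -
        eval_fps (curve_series m a (j \<zeta>)) (\<zeta> * t) = t ^ e \<zeta> * v \<zeta> t"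
      using ne v(3) by (intro eventually_ball_finite fin ballI eventually_conj)
    moreover have "((\<lambda>z :: complex ^ ('a + 1). z $ Inr 1) \<longlongrightarrow> 0) (nhds 0)"
      using holo_tendsto[OF holo_nth, of "Inr 1"] by simp
    ultimately have "\<forall>\<^sub>F z :: complex ^ ('a + 1) in nhds 0. \<forall>\<zeta>\<in>\<mu>. v \<zeta> (z $ Inr 1) \<noteq> 0 \<and>
        eval_fps (curve_series m a (j \<zeta>)) (z $ Inr 1) -
        eval_fps (curve_series m a (j \<zeta>)) (\<zeta> * z $ Inr 1) = (z $ Inr 1) ^ e \<zeta> * v \<zeta> (z $ Inr 1)"
      by (rule eventually_compose_filterlim)
    with w(2) have eq: "\<forall>\<^sub>F z in nhds 0. (z $ Inr 1) ^ (sum e \<mu> + 2 * M) * k z =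
        f z $ Inr (Inl (Min UNIV)) * (f z $ Inr (Inl (Min UNIV)) * w (f z))"
    proof eventually_elim
      case (elim z)
      have "w (f z) = k z * (\<Prod>\<zeta>\<in>\<mu>. inverse (v \<zeta> (z $ Inr 1)) * ((z $ Inr 1) ^ e \<zeta> * v \<zeta> (z $ Inr 1)))"
        using elim by (simp add: h_def mult.assoc flip: prod.distrib)
      also have "(\<Prod>\<zeta>\<in>\<mu>. inverse (v \<zeta> (z $ Inr 1)) * ((z $ Inr 1) ^ e \<zeta> * v \<zeta> (z $ Inr 1))) = (\<Prod>\<zeta>\<in>\<mu>. (z $ Inr 1) ^ e \<zeta>)"
        using elim(2) by (intro prod.cong) auto
      also have "\<dots> = (z $ Inr 1) ^ sum e \<mu>" by (simp add: power_sum)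
      finally show ?case
        by (simp add: curve_series_Min M_def power_add mult_2 mult_ac)
    qed
    show ?thesis
      by (rule flat_pullback_mult[where A = "\<lambda>Z. Z $ Inr (Inl (Min UNIV))"
            and B = "\<lambda>Z. Z $ Inr (Inl (Min UNIV)) * w Z"]) (use eq w in auto)
  qed
  then show ?thesis by blast
qed

text \<open>The part \<open>x i ^ (lam i * b) * y ^ b\<close> is the \<open>b\<close>-th power of a
  target coordinate, and \<open>q\<close> depends on \<open>x\<close> alone. At least two factors
  \<open>x i\<close> are left over for flatness.\<close>

lemma flat_pullback_monomial:
  assumes "holo q" "lam i * b + 2 \<le> L"
  shows "flat_pullback f (\<lambda>z. (z $ Inl i) ^ L * ((z $ Inr 1) ^ b * q (restr (- {Inr 1}) z)))"
proof -
  define S :: "complex ^ ('a + 'k + 'a) \<Rightarrow> complex ^ ('a + 1)" where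
    "S = (\<lambda>Z. \<chi> s. case s of Inl i \<Rightarrow> Z $ Inl i | Inr _ \<Rightarrow> 0)"
  \<comment> \<open>One spare factor \<open>x i\<close> is set aside for the other germ; at least
    one remains here, so \<open>B 0 = 0\<close> even when \<open>b = 0\<close>.\<close>
  define B where "B = (\<lambda>Z. (Z $ Inl i) ^ (L - lam i * b - 1) * ((Z $ Inr (Inr i)) ^ b * q (S Z)))"
  have "holo (\<lambda>Z. q (S Z))"
  proof (rule holo_compose[OF assms(1)])
    show "holo (\<lambda>Z. S Z $ s)" for s by (cases s) (auto simp: S_def)
  qed (auto simp: S_def vec_eq_iff split: sum.split)
  then have "holo B" unfolding B_def by (intro holo_mult holo_power holo_nth)
  have Sf: "S (f z) = restr (- {Inr 1}) z" for z
    by (auto simp: S_def restr_def vec_eq_iff split: sum.split)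
  obtain d where d: "L = lam i * b + 2 + d" using assms(2) le_Suc_ex by blast
  show ?thesis
  proof (rule flat_pullback_mult[where A = "\<lambda>Z. Z $ Inl i" and B = B])
    show "B 0 = 0" by (simp add: B_def d)
    show "\<forall>\<^sub>F z in nhds 0. (z $ Inl i) ^ L * ((z $ Inr 1) ^ b * q (restr (- {Inr 1}) z)) = f z $ Inl i * B (f z)"
      by (simp add: B_def Sf d power_add power_mult_distrib mult_ac flip: power_mult)
  qed (use \<open>holo B\<close> in auto)
qed

lemma A_finite_f: "A_finite f"
proof -
  obtain c where c: "\<And>k. holo k \<Longrightarrow> flat_pullback f (\<lambda>z. (z $ Inr 1) ^ c * k z)"
    using flat_pullback_conductor by blast
  \<comment> \<open>Chosen uniformly in \<open>i\<close> and \<open>b < c\<close>: the sum bounds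
    each \<open>lam i\<close>, and \<open>2\<close> is the margin for flatness.\<close>
  define L where "L = sum lam UNIV * c + 2"
  define e :: "'a + 1 \<Rightarrow> nat" where "e = (\<lambda>s. case s of Inl _ \<Rightarrow> L | Inr _ \<Rightarrow> c)"
  have L: "lam i * b + 2 \<le> L" if "b < c" for i b
    unfolding L_def using that member_le_sum[of i UNIV lam] by (intro add_right_mono mult_mono) auto
  show ?thesis
  proof (rule A_finite_if_flat_pullback[OF holomorphic_germ_f])
    fix h :: "complex ^ ('a + 1) \<Rightarrow> complex"
    \<comment> \<open>One more than the sum of the exponents gives the strict inequality in
      \<open>monomial_ideal\<close>.\<close>
    assume h: "holo h" "vanishes (Suc (sum e UNIV)) h"
    obtain u where u: "\<And>s. holo (u s)" "\<forall>\<^sub>F z in nhds 0. h z = (\<Sum>s\<in>UNIV. (z $ s) ^ e s * u s z)"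
      using monomial_ideal[of h UNIV "Suc (sum e UNIV)" e] h by (auto simp: restr_def)
    have "flat_pullback f (\<lambda>z. (z $ s) ^ e s * u s z)" for s
    proof (cases s)
      case (Inr t)
      moreover have "t = 1" by (rule num1_eq1)
      ultimately show ?thesis using c[OF u(1)[of s]] by (simp add: e_def)
    next
      case (Inl i)
      obtain q k where qk: "\<And>b. holo (q b)" "holo k"
        "\<And>z. u s z = (\<Sum>b<c. (z $ Inr 1) ^ b * q b (restr (- {Inr 1}) z)) + (z $ Inr 1) ^ c * k z"
        using coordinate_expansion[OF u(1)[of s], where c = c and i = "Inr 1"] by blast
      \<comment> \<open>Powers of \<open>y\<close> below \<open>c\<close> pair with
        \<open>x i ^ L\<close>; in the remainder \<open>x i ^ L\<close> joins the arbitrary factor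
        that the conductor allows.\<close>
      have "flat_pullback f (\<lambda>z. (\<Sum>b<c. (z $ Inl i) ^ L * ((z $ Inr 1) ^ b * q b (restr (- {Inr 1}) z))) +
          (z $ Inr 1) ^ c * ((z $ Inl i) ^ L * k z))"
        using qk(1,2) L
        by (intro flat_pullback_add flat_pullback_sum flat_pullback_monomial c holo_mult holo_power holo_nth) auto
      moreover have "(z $ s) ^ e s * u s z = (\<Sum>b<c. (z $ Inl i) ^ L * ((z $ Inr 1) ^ b * q b (restr (- {Inr 1}) z))) +
          (z $ Inr 1) ^ c * ((z $ Inl i) ^ L * k z)" for z
        unfolding qk(3) by (simp add: Inl e_def distrib_left sum_distrib_left mult_ac)
      ultimately show ?thesis by simp
    qed
    then show "flat_pullback f h"
      by (intro flat_pullback_cong[OF flat_pullback_sum u(2)])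
  qed
qed

text \<open>Only the identity block has a linear part: the curve has order at least two, and so has
  \<open>x i ^ lam i * y\<close> because \<open>lam i \<ge> 1\<close>.\<close>

lemma corank_f: "corank f = 1"
proof -
  define D :: "complex ^ ('a + 1) \<Rightarrow> complex ^ ('a + 'k + 'a)" where
    "D = (\<lambda>v. \<chi> s. case s of Inl i \<Rightarrow> v $ Inl i | Inr _ \<Rightarrow> 0)"
  have "(f has_derivative D) (at 0)"
  proof (rule has_derivative_vecI)
    fix s
    have coord: "((\<lambda>z :: complex ^ ('a + 1). z $ t) has_derivative (\<lambda>v. v $ t)) (at 0)" for t
      by (intro bounded_linear_imp_has_derivative bounded_linear_vec_nth)
    show "((\<lambda>z. f z $ s) has_derivative (\<lambda>v. D v $ s)) (at 0)"
    proof (cases s)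
      case (Inl i)
      then show ?thesis using coord by (simp add: D_def)
    next
      case (Inr t)
      show ?thesis
      proof (cases t)
        case (Inl j)
        have "(eval_fps (curve_series m a j) has_field_derivative eval_fps (fps_deriv (curve_series m a j)) 0) (at 0)"
          by (rule has_field_derivative_eval_fps) (use radius in \<open>simp add: zero_ereal_def\<close>)
        then have "(eval_fps (curve_series m a j) has_derivative (\<lambda>_. 0)) (at ((0 :: complex ^ ('a + 1)) $ Inr 1))"
          by (simp add: eval_fps_at_0 curve_series_nth_low has_field_derivative_def lambda_zero)
        from has_derivative_compose[OF coord this] show ?thesis
          using Inr Inl by (simp add: D_def)
      next
        case Inr': (Inr i)
        have "holo (\<lambda>z :: complex ^ ('a + 1). (z $ Inl i) ^ lam i)" by (intro holo_power holo_nth)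
        then obtain A where "((\<lambda>z :: complex ^ ('a + 1). (z $ Inl i) ^ lam i) has_derivative A) (at 0)"
          using holo_imp_cdiff unfolding cdiff_at_def by blast
        from has_derivative_mult[OF this coord[of "Inr 1"]] show ?thesis
          using Inr Inr' lam[rule_format, of i] by (simp add: D_def power_0_left)
      qed
    qed
  qed
  then have "frechet_derivative f (at 0) = D" by (metis frechet_derivative_at)
  moreover have "rank (matrix D) = CARD('a)"
  proof -
    define B :: "(complex ^ ('a + 1)) set" where "B = range (\<lambda>i. axis (Inl i) 1)"
    \<comment> \<open>The rows are distinct standard basis vectors and zeros, so the rank is read
      off as a row rank.\<close>
    have row: "row s (matrix D) = (case s of Inl i \<Rightarrow> axis (Inl i) 1 | Inr _ \<Rightarrow> 0)" for s
      by (auto simp: row_def matrix_def D_def axis_def vec_eq_iff split: sum.split)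
    have "rows (matrix D) = insert 0 B"
    proof -
      have "rows (matrix D) = range (\<lambda>s. row s (matrix D))" by (auto simp: rows_def)
      also have "\<dots> = insert 0 B"
        by (auto simp: UNIV_sum image_Un image_image row B_def)
      finally show ?thesis .
    qed
    then have "rank (matrix D) = vec.dim (insert 0 B)"
      by (simp add: row_rank_def_gen)
    also have "\<dots> = vec.dim B" by (metis vec.dim_span vec.span_insert_0)
    also have "\<dots> = card B"
    proof (rule vec.dim_eq_card_independent, rule vec.independent_mono[OF independent_cart_basis])
      show "B \<subseteq> cart_basis" by (auto simp: B_def cart_basis_def)
    qed
    also have "\<dots> = CARD('a)"
      unfolding B_def by (rule card_image) (auto simp: inj_on_def axis_eq_axis)
    finally show ?thesis .
  qed
  ultimately show ?thesis by (simp add: corank_def card_UNIV_sum)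
qed

end

theorem proposition3p2:
  fixes m :: "'k :: {finite, linorder} \<Rightarrow> nat"
    and a :: "'k \<Rightarrow> nat \<Rightarrow> complex"
    and lam :: "'a :: finite \<Rightarrow> nat"
    and f :: "complex ^ ('a + 1) \<Rightarrow> complex ^ ('a + 'k + 'a)"
  assumes "CARD('a + 1) \<ge> 2" and "CARD('k) \<ge> 2"
    and "1 < m (Min UNIV)" and "mono m"
    and "\<forall>j. fps_conv_radius (curve_series m a j) > 0"
    and "primitive (curve_series m a)"
    and "\<forall>i. lam i \<ge> 1"
    and "f = join id (curve (curve_series m a)) (xpow_times_y lam)"
  shows "A_finite f \<and> corank f = 1"
proof -
  interpret primitive_join m a lam f
    using assms by unfold_locales
  show ?thesis using A_finite_f corank_f by blast
qed

end
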